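(* Let $\Omega$, $B$, $\phi$, $\epsilon>0$, $D$, $d$, $b$ and $m$ be as in the context; in particular $m-\frac12\nabla\cdot b\ge 0$. Consider the bilinear form on $H^1_0(B)$ $$a(u,v) := \int_B \phi D\,\nabla u\cdot\nabla(\phi v)+D\,\big(\nabla\phi\cdot\nabla(\phi u)\big)\,v+\frac{D}{\epsilon^{2}}(1-\phi)\,uv+\phi^2\,(b\cdot\nabla u)\,v+\phi\,[b\cdot\nabla\phi]^{+}\,uv+\phi^2 m\,uv\;dx .$$ Then $a$ is coercive: there is a constant $C>0$ such that $a(u,u)\ge C\|u\|^2$ for all $u\in H^1_0(B)$, with respect to the norm $$\|u\|^2 := \int_B |\nabla(\phi u)|^2+\epsilon^{-2}(1-\phi)|u|^2\;dx .$$
   Context: $\Omega\subset\mathbb{R}^n$ is a sufficiently smooth bounded domain, and $B\supset\Omega$ is a larger bounded domain. $r$ is the signed distance function of $\Omega$ (negative in $\Omega$, positive outside, $|\nabla r|=1$ almost everywhere). For a fixed parameter $\epsilon>0$ the phase-field function is $$\phi(x)=\tfrac12\left(1-\tanh\left(\tfrac{3r(x)}{\epsilon}\right)\right),\quad x\in B,$$ so $\phi$ takes values in $(0,1)$ and $\nabla\phi=-\frac{6}{\epsilon}\phi(1-\phi)\nabla r$. $D:B\to\mathbb{R}$ is a bounded scalar function with $D(x)\ge d>0$ for a constant $d$. $b:B\to\mathbb{R}^n$ is a given velocity field with $b\in W^{1,\infty}(B)^n$ and $m\in L^\infty(B)$ is a given scalar function, satisfying $m-\frac12\nabla\cdot b\ge0$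 in $B$. Notation: $[w]^+=\max(w,0)$. *)

theory Defs
  imports "HOL-Analysis.Analysis"
begin

text \<open>
  Functions on an open set \<open>B\<close> are total functions of which only the values on \<open>B\<close> matter, and
  elements of Sobolev and Lebesgue spaces are represented by individual functions, with no
  quotient by almost-everywhere equality.
\<close>

definition open_domain :: "(real^'n) set \<Rightarrow> bool" where
  "open_domain S \<longleftrightarrow> open S \<and> connected S \<and> S \<noteq> {}"

definition partial_deriv :: "'n::finite \<Rightarrow> (real^'n \<Rightarrow> real) \<Rightarrow> real^'n \<Rightarrow> real" where
  "partial_deriv i f x = frechet_derivative f (at x) (axis i 1)"

text \<open>Only meaningful for open \<open>U\<close>.\<close>

primrec Ck_on :: "nat \<Rightarrow> (real^'n::finite) set \<Rightarrow> (real^'n \<Rightarrow> real) \<Rightarrow> bool" where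
  "Ck_on 0 U f \<longleftrightarrow> continuous_on U f"
| "Ck_on (Suc k) U f \<longleftrightarrow>
     (\<forall>x\<in>U. f differentiable (at x)) \<and> (\<forall>i. Ck_on k U (partial_deriv i f))"

text \<open>
  The boundary is of class \<open>C\<^sup>k\<close>: near each of its points the set is a sublevel set of
  a \<open>C\<^sup>k\<close> function with nonvanishing gradient.
\<close>

definition Ck_boundary :: "nat \<Rightarrow> (real^'n::finite) set \<Rightarrow> bool" where
  "Ck_boundary k S \<longleftrightarrow>
     (\<forall>p\<in>frontier S. \<exists>U \<rho>. open U \<and> p \<in> U \<and> Ck_on k U \<rho> \<and>
        (\<forall>x\<in>U. \<exists>i. partial_deriv i \<rho> x \<noteq> 0) \<and> S \<inter> U = {x \<in> U. \<rho> x < 0})"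

definition signed_distance :: "(real^'n::finite) set \<Rightarrow> real^'n \<Rightarrow> real" where
  "signed_distance S x = (if x \<in> S then - infdist x (- S) else infdist x S)"

definition phase_field :: "real \<Rightarrow> (real^'n::finite) set \<Rightarrow> real^'n \<Rightarrow> real" where
  "phase_field \<epsilon> S x = (1/2) * (1 - tanh (3 * signed_distance S x / \<epsilon>))"

definition test_functions :: "(real^'n::finite) set \<Rightarrow> (real^'n \<Rightarrow> real) set" where
  "test_functions B = {\<psi>. (\<forall>k. Ck_on k UNIV \<psi>) \<and>
     compact (closure {x. \<psi> x \<noteq> 0}) \<and> closure {x. \<psi> x \<noteq> 0} \<subseteq> B}"

definition has_weak_gradient ::
  "(real^'n::finite) set \<Rightarrow> (real^'n \<Rightarrow> real) \<Rightarrow> (real^'n \<Rightarrow> real^'n) \<Rightarrow> bool" where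
  "has_weak_gradient B u G \<longleftrightarrow>
     (\<forall>K. compact K \<and> K \<subseteq> B \<longrightarrow> u absolutely_integrable_on K \<and> G absolutely_integrable_on K) \<and>
     (\<forall>\<psi>\<in>test_functions B. \<forall>i.
        (LINT x|lebesgue_on B. u x * partial_deriv i \<psi> x) = - (LINT x|lebesgue_on B. G x $ i * \<psi> x))"

text \<open>The weak gradient, determined up to null sets whenever it exists.\<close>

definition weak_grad :: "(real^'n::finite) set \<Rightarrow> (real^'n \<Rightarrow> real) \<Rightarrow> real^'n \<Rightarrow> real^'n" where
  "weak_grad B u = (SOME G. has_weak_gradient B u G)"

definition weak_div :: "(real^'n::finite) set \<Rightarrow> (real^'n \<Rightarrow> real^'n) \<Rightarrow> real^'n \<Rightarrow> real" where
  "weak_div B b x = (\<Sum>i\<in>UNIV. weak_grad B (\<lambda>y. b y $ i) x $ i)"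

definition L2 :: "(real^'n::finite) set \<Rightarrow> (real^'n \<Rightarrow> 'b::euclidean_space) set" where
  "L2 B = {f \<in> borel_measurable (lebesgue_on B). integrable (lebesgue_on B) (\<lambda>x. (norm (f x))\<^sup>2)}"

definition Linf :: "(real^'n::finite) set \<Rightarrow> (real^'n \<Rightarrow> 'b::euclidean_space) set" where
  "Linf B = {f \<in> borel_measurable (lebesgue_on B). \<exists>M. AE x in lebesgue_on B. norm (f x) \<le> M}"

definition W1inf :: "(real^'n::finite) set \<Rightarrow> (real^'n \<Rightarrow> real) set" where
  "W1inf B = {f \<in> Linf B. \<exists>G \<in> Linf B. has_weak_gradient B f G}"

definition H1 :: "(real^'n::finite) set \<Rightarrow> (real^'n \<Rightarrow> real) set" where
  "H1 B = {u \<in> L2 B. \<exists>G \<in> L2 B. has_weak_gradient B u G}"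

definition H1_norm :: "(real^'n::finite) set \<Rightarrow> (real^'n \<Rightarrow> real) \<Rightarrow> real" where
  "H1_norm B u = sqrt (LINT x|lebesgue_on B. (u x)\<^sup>2 + (norm (weak_grad B u x))\<^sup>2)"

text \<open>The closure of the test functions in \<open>H1 B\<close>.\<close>

definition H10 :: "(real^'n::finite) set \<Rightarrow> (real^'n \<Rightarrow> real) set" where
  "H10 B = {u \<in> H1 B. \<exists>\<psi>. (\<forall>k::nat. \<psi> k \<in> test_functions B) \<and>
     (\<lambda>k. H1_norm B (\<lambda>x. u x - \<psi> k x)) \<longlonglongrightarrow> 0}"

definition phase_field_form ::
  "(real^'n::finite) set \<Rightarrow> real \<Rightarrow> (real^'n \<Rightarrow> real) \<Rightarrow> (real^'n \<Rightarrow> real) \<Rightarrow> (real^'n \<Rightarrow> real^'n) \<Rightarrow>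
   (real^'n \<Rightarrow> real) \<Rightarrow> (real^'n \<Rightarrow> real) \<Rightarrow> (real^'n \<Rightarrow> real) \<Rightarrow> real" where
  "phase_field_form B \<epsilon> \<phi> D b m u v =
     (LINT x|lebesgue_on B.
        \<phi> x * D x * (weak_grad B u x \<bullet> weak_grad B (\<lambda>y. \<phi> y * v y) x)
      + D x * (weak_grad B \<phi> x \<bullet> weak_grad B (\<lambda>y. \<phi> y * u y) x) * v x
      + D x / \<epsilon>\<^sup>2 * (1 - \<phi> x) * u x * v x
      + (\<phi> x)\<^sup>2 * (b x \<bullet> weak_grad B u x) * v x
      + \<phi> x * max (b x \<bullet> weak_grad B \<phi> x) 0 * u x * v x
      + (\<phi> x)\<^sup>2 * m x * u x * v x)"

definition phase_field_norm ::
  "(real^'n::finite) set \<Rightarrow> real \<Rightarrow> (real^'n \<Rightarrow> real) \<Rightarrow> (real^'n \<Rightarrow> real) \<Rightarrow> real" where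
  "phase_field_norm B \<epsilon> \<phi> u =
     sqrt (LINT x|lebesgue_on B.
        (norm (weak_grad B (\<lambda>y. \<phi> y * u y) x))\<^sup>2 + (1 / \<epsilon>\<^sup>2) * (1 - \<phi> x) * (u x)\<^sup>2)"

end

(*
  Writing D \<phi> \<nabla>u \<cdot> \<nabla>(\<phi> u) + D \<nabla>\<phi> \<cdot> \<nabla>(\<phi> u) u = D |\<nabla>(\<phi> u)|^2 turns the diffusive part of a(u, u) into at least d times
  the squared norm.  Integrating \<phi>^2 b \<cdot> \<nabla>(u^2) / 2 by parts, the remaining terms become
  \<phi> ([b \<cdot> \<nabla>\<phi>]^+ - b \<cdot> \<nabla>\<phi>) u^2 + \<phi>^2 (m - div b / 2) u^2 \<ge> 0, so C = d works.

  The weak gradient of the Lipschitz function \<phi> is obtained without Rademacher's theorem: the smooth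
  functions within 1/n of \<phi> whose partial derivatives are bounded by L form a decreasing sequence of midpoint-convex
  sets (nonempty by mollification), and almost minimisers of the Dirichlet energy over B in these sets have
  Cauchy gradients by the parallelogram law.  The limit is the weak gradient of \<phi>, and the product rule and
  the integration by parts pass from the smooth approximants of \<phi> and u to the limit.
*)
theory Submission
  imports Defs
begin

section \<open>Smooth functions and bump functions\<close>

text \<open>\<open>weak_grad\<close> picks an arbitrary weak gradient, and \<open>H1_norm\<close>,
  the form and the norm are all written with it. Nothing can be computed from it before weak
  gradients are known to be unique almost everywhere. This is why a supply of test functions and the
  fundamental lemma of the calculus of variations precede all weak calculus. The parallelogram
  argument is the one for the point of least norm in a closed convex set, run along a decreasing
  sequence of sets. It takes the place of weak compactness: gradients converge almost everywhere and
  not just weakly, so that each passage to the limit in the smooth approximants of \<phi> is an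
  instance of dominated convergence. A Bochner integral that does not exist has the value 0, so the
  integral of the form may be split only after every summand is known to be integrable. The summands
  are therefore kept in the shape "bounded coefficient times product of two L2 functions".
  Membership of u in \<open>H10\<close> enters through approximation by test functions, which leaves
  no boundary term.\<close>

definition smooth :: "(real^'n::finite \<Rightarrow> real) \<Rightarrow> bool" where
  "smooth f \<longleftrightarrow> (\<forall>k. Ck_on k UNIV f)"

section \<open>Calculus of partial derivatives\<close>

lemma partial_deriv_eqI:
  assumes "(f has_derivative f') (at x)"
  shows "partial_deriv i f x = f' (axis i 1)"
  using frechet_derivative_at[OF assms] by (simp add: partial_deriv_def)

lemma has_derivative_partial:
  assumes "f differentiable (at x)"
  shows "(f has_derivative frechet_derivative f (at x)) (at x)"
  using assms frechet_derivative_works by blast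

lemma partial_deriv_add:
  assumes "f differentiable (at x)" "g differentiable (at x)"
  shows "partial_deriv i (\<lambda>x. f x + g x) x = partial_deriv i f x + partial_deriv i g x"
  using partial_deriv_eqI[OF has_derivative_add[OF assms[THEN has_derivative_partial]], of i]
  by (simp add: partial_deriv_def)

lemma partial_deriv_mult:
  assumes "f differentiable (at x)" "g differentiable (at x)"
  shows "partial_deriv i (\<lambda>x. f x * g x) x = f x * partial_deriv i g x + partial_deriv i f x * g x"
  using partial_deriv_eqI[OF has_derivative_mult[OF assms[THEN has_derivative_partial]], of i]
  by (simp add: partial_deriv_def)

lemma partial_deriv_const [simp]: "partial_deriv i (\<lambda>x. c) = (\<lambda>x. 0)"
  by (simp add: partial_deriv_def fun_eq_iff)

lemma Ck_on_const: "Ck_on k U (\<lambda>x. c)"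
  by (induction k arbitrary: c) auto

lemma Ck_on_Suc_imp: "Ck_on (Suc k) U f \<Longrightarrow> Ck_on k U f"
proof (induction k arbitrary: f)
  case 0 then show ?case
    by (auto intro!: continuous_at_imp_continuous_on differentiable_imp_continuous_within)
next
  case (Suc k)
  have "f differentiable (at x)" if "x \<in> U" for x
    using Suc.prems that by simp
  moreover have "Ck_on k U (partial_deriv i f)" for i
    using Suc.prems by (intro Suc.IH) simp
  ultimately show ?case by simp
qed

lemma Ck_add: "Ck_on k UNIV f \<Longrightarrow> Ck_on k UNIV g \<Longrightarrow> Ck_on k UNIV (\<lambda>x. f x + g x)"
proof (induction k arbitrary: f g)
  case 0 then show ?case by (simp add: continuous_on_add continuous_on_mult)
next
  case (Suc k)
  have d: "f differentiable (at x)" "g differentiable (at x)" for x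
    using Suc.prems by simp_all
  then have eq: "partial_deriv i (\<lambda>x. f x + g x) = (\<lambda>x. partial_deriv i f x + partial_deriv i g x)" for i
    by (simp add: partial_deriv_add fun_eq_iff)
  have "Ck_on k UNIV (partial_deriv i (\<lambda>x. f x + g x))" for i
    unfolding eq using Suc.prems by (intro Suc.IH) simp_all
  then show ?case by (simp add: d)
qed

lemma Ck_mult: "Ck_on k UNIV f \<Longrightarrow> Ck_on k UNIV g \<Longrightarrow> Ck_on k UNIV (\<lambda>x. f x * g x)"
proof (induction k arbitrary: f g)
  case 0 then show ?case by (simp add: continuous_on_add continuous_on_mult)
next
  case (Suc k)
  have d: "f differentiable (at x)" "g differentiable (at x)" for x
    using Suc.prems by simp_all
  then have eq: "partial_deriv i (\<lambda>x. f x * g x) =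
      (\<lambda>x. f x * partial_deriv i g x + partial_deriv i f x * g x)" for i
    by (simp add: partial_deriv_mult fun_eq_iff)
  have "Ck_on k UNIV (partial_deriv i f)" "Ck_on k UNIV (partial_deriv i g)" for i
    using Suc.prems by simp_all
  \<comment> \<open>In each summand of the product rule one factor stays undifferentiated and has to
    be lowered from \<open>Suc k\<close> to \<open>k\<close>.\<close>
  then have "Ck_on k UNIV (partial_deriv i (\<lambda>x. f x * g x))" for i
    unfolding eq using Suc.prems[THEN Ck_on_Suc_imp] by (intro Suc.IH Ck_add)
  then show ?case by (simp add: d)
qed

lemma smooth_const: "smooth (\<lambda>x. c)" by (simp add: smooth_def Ck_on_const)
lemma smooth_add: "smooth f \<Longrightarrow> smooth g \<Longrightarrow> smooth (\<lambda>x. f x + g x)" by (simp add: smooth_def Ck_add)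
lemma smooth_mult: "smooth f \<Longrightarrow> smooth g \<Longrightarrow> smooth (\<lambda>x. f x * g x)" by (simp add: smooth_def Ck_mult)

lemma smooth_prod: "(\<And>i. i \<in> I \<Longrightarrow> smooth (f i)) \<Longrightarrow> smooth (\<lambda>x. \<Prod>i\<in>I. f i x)"
  by (induction I rule: infinite_finite_induct) (auto intro: smooth_const smooth_mult)

lemma smooth_differentiable: "smooth f \<Longrightarrow> f differentiable (at x)"
  unfolding smooth_def by (metis Ck_on.simps(2) UNIV_I)

lemma smooth_partial_deriv: "smooth f \<Longrightarrow> smooth (partial_deriv i f)"
  unfolding smooth_def by (metis Ck_on.simps(2))

lemma smooth_continuous: "smooth f \<Longrightarrow> continuous_on S f"
  unfolding smooth_def by (metis Ck_on.simps(1) continuous_on_subset subset_UNIV)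

text \<open>Smoothness is reduced to exhibiting a family of differentiable functions closed under
  partial derivatives, which avoids formulas for iterated derivatives. It is applied to flat
  exponentials and to convolutions.\<close>

lemma smooth_coinduct:
  assumes "f \<in> X" "\<And>f x. f \<in> X \<Longrightarrow> f differentiable (at x)" "\<And>f i. f \<in> X \<Longrightarrow> partial_deriv i f \<in> X"
  shows "smooth f"
proof -
  have "Ck_on k UNIV f" if "f \<in> X" for k f
    using that
  proof (induction k arbitrary: f)
    case 0 then show ?case using assms(2)
      by (simp add: differentiable_imp_continuous_within continuous_at_imp_continuous_on)
  next
    case (Suc k) then show ?case using assms(2,3) by auto
  qed
  with assms(1) show ?thesis by (simp add: smooth_def)
qed

text \<open>The classical flat function exp(-1/t), extended by 0, with a polynomial in 1/t as
  coefficient. The polynomial is a parameter because differentiation changes it: only the whole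
  family is closed under differentiation.\<close>

definition exp_flat :: "real poly \<Rightarrow> real \<Rightarrow> real" where
  "exp_flat p t = (if t > 0 then poly p (1 / t) * exp (- (1 / t)) else 0)"

lemma poly_div_exp_tendsto_0: "((\<lambda>x::real. poly p x * exp (- x)) \<longlongrightarrow> 0) at_top"
proof -
  have "((\<lambda>x::real. \<Sum>i\<le>degree p. coeff p i * (x ^ i / exp x)) \<longlongrightarrow> (\<Sum>i\<le>degree p. coeff p i * 0)) at_top"
    by (intro tendsto_intros tendsto_power_div_exp_0)
  then show ?thesis
    by (simp add: poly_altdef exp_minus field_simps sum_distrib_left sum_distrib_right)
qed

text \<open>With s = 1/t, differentiating p(s) exp(-s) in s gives (p' - p)(s) exp(-s), and ds/dt =
  -s^2. Hence the factor \<open>[:0, 0, 1:]\<close>, which is s^2, and the difference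
  \<open>p - pderiv p\<close>. At t = 0 the exponential beats every power of 1/t.\<close>

lemma exp_flat_derivative:
  "(exp_flat p has_field_derivative exp_flat ([:0, 0, 1:] * (p - pderiv p)) t) (at t)"
proof (rule linorder_cases[of t 0])
  assume t: "t < 0"
  have "((\<lambda>t. 0) has_field_derivative 0) (at t)" by simp
  then have "(exp_flat p has_field_derivative 0) (at t)"
    by (rule has_field_derivative_transform_within_open[where S="{..<0}"]) (use t in \<open>auto simp: exp_flat_def\<close>)
  then show ?thesis using t by (simp add: exp_flat_def)
next
  assume t: "t > 0"
  have "((\<lambda>t. poly p (1 / t) * exp (- (1 / t))) has_field_derivative
      poly ([:0, 0, 1:] * (p - pderiv p)) (1 / t) * exp (- (1 / t))) (at t)"
    using t by (auto intro!: derivative_eq_intros simp: field_simps power2_eq_square)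
  then have "(exp_flat p has_field_derivative poly ([:0, 0, 1:] * (p - pderiv p)) (1 / t) * exp (- (1 / t))) (at t)"
    by (rule has_field_derivative_transform_within_open[where S="{0<..}"]) (use t in \<open>auto simp: exp_flat_def\<close>)
  then show ?thesis using t by (simp add: exp_flat_def)
next
  assume t: "t = 0"
  \<comment> \<open>For h > 0 the difference quotient at 0 is (1/h) p(1/h) exp(-1/h); the extra 1/h
    is the factor \<open>[:0, 1:]\<close>.\<close>
  have "((\<lambda>h. poly ([:0, 1:] * p) (inverse h) * exp (- (inverse h))) \<longlongrightarrow> 0) (at_right (0::real))"
    by (rule filterlim_compose[OF poly_div_exp_tendsto_0 filterlim_inverse_at_top_right])
  then have r: "((\<lambda>h. exp_flat p h / h) \<longlongrightarrow> 0) (at_right 0)"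
    by (rule Lim_transform_eventually)
       (auto simp: eventually_at_filter exp_flat_def field_simps)
  have l: "((\<lambda>h. exp_flat p h / h) \<longlongrightarrow> 0) (at_left 0)"
    by (rule Lim_transform_eventually[OF tendsto_const])
       (auto simp: eventually_at_filter exp_flat_def)
  from l r have "((\<lambda>h. exp_flat p h / h) \<longlongrightarrow> 0) (at 0)"
    by (simp add: filterlim_at_split)
  then show ?thesis using t by (simp add: DERIV_def exp_flat_def)
qed

lemma smooth_exp_flat: "smooth (\<lambda>x::real^'n::finite. exp_flat p (s * x $ i + a))"
proof (rule smooth_coinduct)
  \<comment> \<open>The constant c in the family absorbs the chain rule factor
    \<open>s * axis j 1 $ i\<close>, which is 0 for j different from i.\<close>
  let ?X = "{f. \<exists>c p. f = (\<lambda>x::real^'n. c * exp_flat p (s * x $ i + a))}"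
  have "(\<lambda>x. exp_flat p (s * x $ i + a)) = (\<lambda>x. 1 * exp_flat p (s * x $ i + a))" by simp
  then show "(\<lambda>x. exp_flat p (s * x $ i + a)) \<in> ?X" by (intro CollectI exI)
  have D: "((\<lambda>x::real^'n. c * exp_flat p (s * x $ i + a)) has_derivative
      (\<lambda>h. c * (s * h $ i * exp_flat ([:0, 0, 1:] * (p - pderiv p)) (s * x $ i + a)))) (at x)" for c p x
  proof -
    have "((\<lambda>x::real^'n. s * x $ i + a) has_derivative (\<lambda>h. s * h $ i)) (at x)"
      by (auto intro!: derivative_eq_intros bounded_linear_imp_has_derivative bounded_linear_vec_nth)
    then have "((\<lambda>x::real^'n. exp_flat p (s * x $ i + a)) has_derivative
      (\<lambda>h. s * h $ i * exp_flat ([:0, 0, 1:] * (p - pderiv p)) (s * x $ i + a))) (at x)"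
      using has_derivative_compose[OF _ exp_flat_derivative[unfolded has_field_derivative_def]]
      by (auto simp: mult.commute)
    then show ?thesis by (rule has_derivative_mult_right)
  qed
  show "f differentiable (at x)" if "f \<in> ?X" for f x
    using that D by (auto simp: differentiable_def)
  show "partial_deriv j f \<in> ?X" if "f \<in> ?X" for f j
  proof -
    from that have "\<exists>c p. f = (\<lambda>x. c * exp_flat p (s * x $ i + a))" by simp
    then obtain c p where f: "f = (\<lambda>x. c * exp_flat p (s * x $ i + a))" by (elim exE)
    have "partial_deriv j f = (\<lambda>x. (c * s * (axis j 1 $ i)) * exp_flat ([:0, 0, 1:] * (p - pderiv p)) (s * x $ i + a))"
      unfolding f by (rule ext, subst partial_deriv_eqI[OF D]) (simp add: algebra_simps)
    then show ?thesis by (intro CollectI exI)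
  qed
qed

text \<open>A tensor product, so that one-dimensional flat functions suffice; for positive \<delta>
  its support is a cube. Both factors carry an explicit coefficient to match
  \<open>smooth_exp_flat\<close>.\<close>

definition bump :: "real \<Rightarrow> real^'n::finite \<Rightarrow> real" where
  "bump \<delta> x = (\<Prod>i\<in>UNIV. exp_flat 1 (1 * x $ i + \<delta>) * exp_flat 1 ((-1) * x $ i + \<delta>))"

lemma smooth_bump: "smooth (bump \<delta>)"
  unfolding bump_def[abs_def] by (intro smooth_prod smooth_mult smooth_exp_flat)

lemma bump_nonneg: "bump \<delta> x \<ge> 0"
  unfolding bump_def exp_flat_def by (intro prod_nonneg) auto

lemma bump_pos_iff: "bump \<delta> x > 0 \<longleftrightarrow> (\<forall>i. \<bar>x $ i\<bar> < \<delta>)"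
proof
  assume *: "bump \<delta> x > 0"
  show "\<forall>i. \<bar>x $ i\<bar> < \<delta>"
  proof
    fix i
    have "exp_flat 1 (1 * x $ i + \<delta>) * exp_flat 1 ((-1) * x $ i + \<delta>) \<noteq> 0"
      using * unfolding bump_def by (metis (no_types, lifting) UNIV_I finite less_irrefl prod_zero_iff)
    then show "\<bar>x $ i\<bar> < \<delta>" by (auto simp: exp_flat_def split: if_splits)
  qed
next
  assume "\<forall>i. \<bar>x $ i\<bar> < \<delta>"
  then have "exp_flat 1 (1 * x $ i + \<delta>) > 0" "exp_flat 1 ((-1) * x $ i + \<delta>) > 0" for i
    by (auto simp: exp_flat_def abs_less_iff add_pos_pos minus_less_iff add.commute)
       (smt (verit, best))+
  then show "bump \<delta> x > 0" unfolding bump_def by (intro prod_pos) (metis mult_pos_pos)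
qed

section \<open>Mollification of Lipschitz functions\<close>

text \<open>Expressed through partial derivatives, the derivative is visibly a linear map with
  coefficients continuous in the point, as differentiation under the integral requires.\<close>

lemma has_derivative_partial_sum:
  fixes f :: "real^'n::finite \<Rightarrow> real"
  assumes "f differentiable (at x)"
  shows "(f has_derivative (\<lambda>h. \<Sum>i\<in>UNIV. h $ i * partial_deriv i f x)) (at x)"
proof -
  have D: "(f has_derivative frechet_derivative f (at x)) (at x)"
    using assms by (rule has_derivative_partial)
  interpret linear "frechet_derivative f (at x)"
    using D by (rule has_derivative_linear)
  have "frechet_derivative f (at x) h = (\<Sum>i\<in>UNIV. h $ i * partial_deriv i f x)" for h
  proof -
    have "frechet_derivative f (at x) h = frechet_derivative f (at x) (\<Sum>i\<in>UNIV. h $ i *\<^sub>R axis i 1)"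
      by (simp add: basis_expansion flip: scalar_mult_eq_scaleR)
    also have "\<dots> = (\<Sum>i\<in>UNIV. h $ i * partial_deriv i f x)"
      by (simp add: sum scale partial_deriv_def)
    finally show ?thesis .
  qed
  then have "frechet_derivative f (at x) = (\<lambda>h. \<Sum>i\<in>UNIV. h $ i * partial_deriv i f x)" by blast
  with D show ?thesis by simp
qed

lemma partial_deriv_zero_on_open:
  assumes "open S" "x \<in> S" "\<And>y. y \<in> S \<Longrightarrow> f y = 0"
  shows "partial_deriv i f x = 0"
proof -
  have "((\<lambda>y. 0::real) has_derivative (\<lambda>h. 0)) (at x)" by simp
  then have "(f has_derivative (\<lambda>h. 0)) (at x)"
    by (rule has_derivative_transform_within_open[OF _ assms(1,2)]) (use assms(3) in simp)
  then show ?thesis by (simp add: partial_deriv_eqI)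
qed

lemma partial_deriv_zero_outside_cball:
  assumes "\<And>z. norm z > r \<Longrightarrow> f z = 0" "norm z > r"
  shows "partial_deriv i f z = 0"
proof (rule partial_deriv_zero_on_open)
  show "open (- cball 0 r)" by (intro open_Compl closed_cball)
qed (use assms in auto)

text \<open>A bridge from the Lebesgue integral over the whole space to the gauge integral over a
  compact set, for which \<open>leibniz_rule\<close> is stated.\<close>

lemma compact_support_integrable:
  fixes f :: "'a::euclidean_space \<Rightarrow> real"
  assumes "continuous_on UNIV f" "compact K" "\<And>x. x \<notin> K \<Longrightarrow> f x = 0"
  shows "integrable lborel f" "integral\<^sup>L lborel f = integral K f"
proof -
  have "integrable lborel (\<lambda>x. indicator K x *\<^sub>R f x)"
    by (intro borel_integrable_compact assms continuous_on_subset[OF assms(1)]) simp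
  moreover have "(\<lambda>x. indicator K x *\<^sub>R f x) = f"
    using assms(3) by (auto simp: indicator_def fun_eq_iff)
  ultimately show i: "integrable lborel f" by simp
  have "integral\<^sup>L lborel f = integral UNIV f"
    using integral_lborel[OF i] by simp
  also have "\<dots> = integral UNIV (\<lambda>x. if x \<in> K then f x else 0)"
    using assms(3) by (intro arg_cong2[where f=integral]) auto
  finally show "integral\<^sup>L lborel f = integral K f" by (simp add: integral_restrict_UNIV)
qed

text \<open>Convolution, with x only in the second factor, so that all derivatives fall on \<rho>
  and f need only be continuous.\<close>

definition conv :: "(real^'n::finite \<Rightarrow> real) \<Rightarrow> (real^'n \<Rightarrow> real) \<Rightarrow> real^'n \<Rightarrow> real" where
  "conv f \<rho> x = (LINT y|lborel. f y * \<rho> (x - y))"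

lemma conv_derivative:
  fixes f \<rho> :: "real^'n::finite \<Rightarrow> real"
  assumes f: "continuous_on UNIV f" and \<rho>: "smooth \<rho>" and supp: "\<And>z. norm z > r \<Longrightarrow> \<rho> z = 0"
  shows "conv f \<rho> differentiable (at x0)" "partial_deriv i (conv f \<rho>) x0 = conv f (partial_deriv i \<rho>) x0"
proof -
  \<comment> \<open>The radius 1 + |r| lets one box serve all x in the unit ball about
    \<open>x0\<close>: for y outside the box the kernel \<open>\<rho> (x - y)\<close>
    vanishes.\<close>
  obtain c where c: "cball x0 (1 + \<bar>r\<bar>) \<subseteq> cbox (-c) c"
    using bounded_subset_cbox_symmetric[OF bounded_cball] by metis
  have out: "norm (x - y) > r" if "x \<in> ball x0 1" "y \<notin> cbox (-c) c" for x y
  proof -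
    have "dist x0 y > 1 + \<bar>r\<bar>" using c that(2) by (meson mem_cball not_le subsetD)
    then show ?thesis using that(1) norm_triangle_ineq[of "x0 - x" "x - y"] by (simp add: dist_norm)
  qed
  have conv_eq: "conv f \<sigma> x = integral (cbox (-c) c) (\<lambda>y. f y * \<sigma> (x - y))"
    if "x \<in> ball x0 1" "continuous_on UNIV \<sigma>" "\<And>z. norm z > r \<Longrightarrow> \<sigma> z = 0" for x \<sigma>
    unfolding conv_def
  proof (rule compact_support_integrable)
    show "continuous_on UNIV (\<lambda>y. f y * \<sigma> (x - y))"
      by (intro continuous_intros f continuous_on_compose2[OF that(2)]) auto
  qed (use that out in auto)
  \<comment> \<open>The x-derivative of the integrand, as an element of the Banach space of bounded
    linear maps, so that it can be integrated in t.\<close>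
  define fx where "fx x t = (\<Sum>i\<in>UNIV. (f t * partial_deriv i \<rho> (x - t)) *\<^sub>R blinfun_inner_left (axis i 1::real^'n))" for x t
  have cont_p: "continuous_on S (partial_deriv i \<rho>)" for i S
    by (intro smooth_continuous smooth_partial_deriv \<rho>)
  have cont_fx: "continuous_on S (\<lambda>(x, t). fx x t)" for S
    unfolding fx_def case_prod_unfold
    by (intro continuous_intros continuous_on_compose2[OF f] continuous_on_compose2[OF cont_p[of UNIV]]) auto
  have D: "((\<lambda>x. integral (cbox (-c) c) (\<lambda>t. f t * \<rho> (x - t))) has_derivative
      integral (cbox (-c) c) (fx x0)) (at x0 within ball x0 1)"
  proof (rule leibniz_rule)
    fix x t :: "real^'n"
    have "((\<lambda>x. x - t) has_derivative (\<lambda>h. h)) (at x within ball x0 1)"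
      by (auto intro!: derivative_eq_intros)
    from has_derivative_compose[OF this has_derivative_partial_sum[OF smooth_differentiable[OF \<rho>]]]
    have "((\<lambda>x. f t * \<rho> (x - t)) has_derivative
        (\<lambda>h. f t * (\<Sum>i\<in>UNIV. h $ i * partial_deriv i \<rho> (x - t)))) (at x within ball x0 1)"
      by (rule has_derivative_mult_right)
    moreover have "(\<lambda>h. f t * (\<Sum>i\<in>UNIV. h $ i * partial_deriv i \<rho> (x - t))) = blinfun_apply (fx x t)"
      by (rule ext) (simp add: fx_def blinfun.sum_left blinfun.scaleR_left inner_axis sum_distrib_left algebra_simps)
    ultimately show "((\<lambda>x. f t * \<rho> (x - t)) has_derivative blinfun_apply (fx x t)) (at x within ball x0 1)"
      by simp
    show "(\<lambda>t. f t * \<rho> (x - t)) integrable_on cbox (-c) c"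
      by (intro integrable_continuous continuous_intros continuous_on_compose2[OF f]
          continuous_on_compose2[OF smooth_continuous[OF \<rho>, of UNIV]]) auto
  qed (use cont_fx in auto)
  then have "((\<lambda>x. integral (cbox (-c) c) (\<lambda>t. f t * \<rho> (x - t))) has_derivative
      integral (cbox (-c) c) (fx x0)) (at x0)"
    by (simp add: at_within_open[OF _ open_ball])
  then have D': "(conv f \<rho> has_derivative integral (cbox (-c) c) (fx x0)) (at x0)"
    by (rule has_derivative_transform_within_open[OF _ open_ball[of x0 1]])
       (simp_all only: conv_eq[OF _ smooth_continuous[OF \<rho>] supp] centre_in_ball zero_less_one)
  then show "conv f \<rho> differentiable (at x0)" by (auto simp: differentiable_def)
  have "fx x0 integrable_on cbox (-c) c"
  proof (intro integrable_continuous)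
    have "continuous_on (cbox (-c) c) (\<lambda>t. (x0, t))" by (intro continuous_intros)
    from continuous_on_compose2[OF cont_fx this subset_UNIV] show "continuous_on (cbox (-c) c) (fx x0)"
      by simp
  qed
  then have "blinfun_apply (integral (cbox (-c) c) (fx x0)) (axis i 1) =
      integral (cbox (-c) c) (\<lambda>t. blinfun_apply (fx x0 t) (axis i 1))"
    by (subst integral_linear[symmetric, OF _ blinfun.bounded_linear_left]) (auto simp: o_def)
  also have "\<dots> = integral (cbox (-c) c) (\<lambda>t. f t * partial_deriv i \<rho> (x0 - t))"
    by (simp add: fx_def blinfun.sum_left blinfun.scaleR_left inner_axis_axis if_distrib cong: if_cong)
  also have "\<dots> = conv f (partial_deriv i \<rho>) x0"
    by (rule conv_eq[symmetric]) (auto intro: cont_p partial_deriv_zero_outside_cball[OF supp])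
  finally show "partial_deriv i (conv f \<rho>) x0 = conv f (partial_deriv i \<rho>) x0"
    using partial_deriv_eqI[OF D'] by simp
qed

text \<open>Differentiating the kernel keeps it smooth and supported in the same ball, so the
  convolutions of f with such kernels form a family as in \<open>smooth_coinduct\<close>.\<close>

lemma smooth_conv:
  assumes f: "continuous_on UNIV f" and \<rho>: "smooth \<rho>" and supp: "\<And>z. norm z > r \<Longrightarrow> \<rho> z = 0"
  shows "smooth (conv f \<rho>)"
proof (rule smooth_coinduct)
  let ?X = "{conv f \<sigma> |\<sigma>. smooth \<sigma> \<and> (\<forall>z. norm z > r \<longrightarrow> \<sigma> z = 0)}"
  show "conv f \<rho> \<in> ?X" using \<rho> supp by blast
  fix g x i assume "g \<in> ?X"
  then obtain \<sigma> where \<sigma>: "g = conv f \<sigma>" "smooth \<sigma>" "\<And>z. norm z > r \<Longrightarrow> \<sigma> z = 0" by blast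
  show "g differentiable (at x)" unfolding \<sigma>(1) by (rule conv_derivative[OF f \<sigma>(2,3)])
  have "partial_deriv i g = conv f (partial_deriv i \<sigma>)"
    unfolding \<sigma>(1) by (rule ext) (rule conv_derivative[OF f \<sigma>(2,3)])
  moreover have "partial_deriv i \<sigma> z = 0" if "norm z > r" for z
    using \<sigma>(3) that by (rule partial_deriv_zero_outside_cball)
  ultimately show "partial_deriv i g \<in> ?X"
    using smooth_partial_deriv[OF \<sigma>(2)] by blast
qed

section \<open>Reflection and translation invariance of the Lebesgue integral\<close>

lemma lborel_integral_reflect:
  fixes f :: "'a::euclidean_space \<Rightarrow> real"
  shows "(LINT y|lborel. f (x - y)) = (LINT y|lborel. f y)"
proof -
  have "distr lborel borel (\<lambda>y. x + (-1) *\<^sub>R y) = (lborel :: 'a measure)"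
    using lborel_affine[of "-1" x] by (simp add: density_1)
  then have d: "distr lborel borel (\<lambda>y. x - y) = (lborel :: 'a measure)" by simp
  show ?thesis
  proof (cases "f \<in> borel_measurable borel")
    case True
    then show ?thesis using integral_distr[of "\<lambda>y. x - y" lborel borel f] d by simp
  next
    \<comment> \<open>Without measurability both integrals are the default value 0, so the identity
      holds for every f.\<close>
    case False
    have "(\<lambda>y. f (x - y)) \<notin> borel_measurable borel"
    proof
      assume "(\<lambda>y. f (x - y)) \<in> borel_measurable borel"
      then have "(\<lambda>y. f (x - (x - y))) \<in> borel_measurable borel" by measurable
      with False show False by simp
    qed
    with False have "\<not> integrable lborel f" "\<not> integrable lborel (\<lambda>y. f (x - y))"
      by (auto dest!: borel_measurable_integrable)
    then show ?thesis by (simp add: not_integrable_integral_eq)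
  qed
qed

lemma lborel_integral_translate:
  fixes f :: "'a::euclidean_space \<Rightarrow> real"
  shows "(LINT y|lborel. f (y + x)) = (LINT y|lborel. f y)"
  using lborel_integral_reflect[of "\<lambda>y. f (x - y)" 0] lborel_integral_reflect[of f x]
  by (simp add: add.commute)

lemma mollifier_exists:
  assumes "r > 0"
  shows "\<exists>\<rho>::real^'n::finite \<Rightarrow> real. smooth \<rho> \<and> (\<forall>z. \<rho> z \<ge> 0) \<and> (\<forall>z. norm z > r \<longrightarrow> \<rho> z = 0) \<and>
    integrable lborel \<rho> \<and> integral\<^sup>L lborel \<rho> = 1"
proof -
  \<comment> \<open>The Euclidean norm is at most the sum of the absolute values of the n
    coordinates, so a cube of half-side r / n fits into the ball of radius r.\<close>
  define \<delta> where "\<delta> = r / CARD('n)"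
  let ?b = "bump \<delta> :: real^'n \<Rightarrow> real"
  have \<delta>: "\<delta> > 0" using assms by (simp add: \<delta>_def)
  have supp: "?b z = 0" if "norm z > r" for z
  proof (rule ccontr)
    assume "?b z \<noteq> 0"
    then have "?b z > 0" using bump_nonneg[of \<delta> z] by linarith
    then have "\<bar>z $ i\<bar> \<le> \<delta>" for i by (simp add: bump_pos_iff less_imp_le)
    then have "norm z \<le> (\<Sum>i\<in>(UNIV::'n set). \<delta>)"
      by (intro order_trans[OF norm_le_l1_cart] sum_mono)
    with that show False by (simp add: \<delta>_def)
  qed
  have cont: "continuous_on UNIV ?b" by (intro smooth_continuous smooth_bump)
  have int: "integrable lborel ?b"
    by (rule compact_support_integrable[OF cont compact_cball[of 0 r]]) (use supp in auto)
  \<comment> \<open>If the integral vanished, the closed zero set of the bump would have full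
    measure and so contain every point, in particular 0, where the bump is positive.\<close>
  have "integral\<^sup>L lborel ?b \<noteq> 0"
  proof
    assume "integral\<^sup>L lborel ?b = 0"
    then have "AE x in lborel. ?b x = 0"
      using integral_nonneg_eq_0_iff_AE[OF int] bump_nonneg by auto
    then have "AE x in lebesgue. x \<in> {x. ?b x = 0}" by (simp add: AE_completion)
    moreover have "closed {x. ?b x = 0}" by (intro closed_Collect_eq cont continuous_on_const)
    ultimately have "(0::real^'n) \<in> {x. ?b x = 0}" by (rule mem_closed_if_AE_lebesgue[rotated])
    moreover have "?b 0 > 0" using \<delta> by (simp add: bump_pos_iff)
    ultimately show False by simp
  qed
  then have pos: "integral\<^sup>L lborel ?b > 0"
    using Bochner_Integration.integral_nonneg[of lborel ?b, OF bump_nonneg] by linarith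
  show ?thesis
  proof (intro exI conjI allI impI)
    let ?r = "\<lambda>z. inverse (integral\<^sup>L lborel ?b) * ?b z"
    show "smooth ?r" by (intro smooth_mult smooth_const smooth_bump)
    show "?r z \<ge> 0" for z using pos bump_nonneg[of \<delta> z] by simp
    show "?r z = 0" if "norm z > r" for z using supp[OF that] by simp
    show "integrable lborel ?r" using int by simp
    show "integral\<^sup>L lborel ?r = 1" using pos by simp
  qed
qed

lemma partial_deriv_bound:
  assumes "f differentiable (at x)" "\<And>y. \<bar>f y - f x\<bar> \<le> L * dist y x"
  shows "\<bar>partial_deriv i f x\<bar> \<le> L"
proof -
  have "((\<lambda>t. x + t *\<^sub>R axis i 1) has_derivative (\<lambda>t. t *\<^sub>R axis i 1)) (at (0::real))"
    by (auto intro!: derivative_eq_intros)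
  then have "((\<lambda>t. f (x + t *\<^sub>R axis i 1)) has_derivative (\<lambda>t. frechet_derivative f (at x) (t *\<^sub>R axis i 1))) (at 0)"
    using has_derivative_compose[where g=f and f="\<lambda>t. x + t *\<^sub>R axis i 1" and x=0 and s=UNIV]
      has_derivative_partial[OF assms(1)] by simp
  moreover have "(\<lambda>t. frechet_derivative f (at x) (t *\<^sub>R axis i 1)) = (\<lambda>t. partial_deriv i f x * t)"
    using linear_cmul[OF linear_frechet_derivative[OF assms(1)]] by (simp add: partial_deriv_def mult.commute)
  ultimately have "((\<lambda>t. f (x + t *\<^sub>R axis i 1)) has_field_derivative partial_deriv i f x) (at 0)"
    by (simp add: has_field_derivative_def)
  then have "((\<lambda>t. (f (x + t *\<^sub>R axis i 1) - f x) / t) \<longlongrightarrow> partial_deriv i f x) (at 0)"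
    by (simp add: DERIV_def)
  then have "((\<lambda>t. \<bar>(f (x + t *\<^sub>R axis i 1) - f x) / t\<bar>) \<longlongrightarrow> \<bar>partial_deriv i f x\<bar>) (at 0)"
    by (rule tendsto_rabs)
  then show ?thesis
  proof (rule tendsto_upperbound)
    have "\<bar>(f (x + t *\<^sub>R axis i 1) - f x) / t\<bar> \<le> L" if "t \<noteq> 0" for t
      using assms(2)[of "x + t *\<^sub>R axis i 1"] that by (simp add: dist_norm field_simps abs_divide)
    then show "\<forall>\<^sub>F t in at 0. \<bar>(f (x + t *\<^sub>R axis i 1) - f x) / t\<bar> \<le> L"
      by (simp add: eventually_at_filter)
  qed simp
qed

text \<open>Mollification averages translates of f, so it keeps the Lipschitz constant and with it
  the bound on partial derivatives; it moves values by at most L r, where r is the radius of the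
  mollifier. The last clause controls supports and turns Lipschitz cutoffs into test
  functions.\<close>

lemma lipschitz_smooth_approx:
  fixes f :: "real^'n::finite \<Rightarrow> real"
  assumes lip: "\<And>x y. \<bar>f x - f y\<bar> \<le> L * dist x y" and e: "e > 0"
  shows "\<exists>g. smooth g \<and> (\<forall>x. \<bar>g x - f x\<bar> \<le> e) \<and> (\<forall>i x. \<bar>partial_deriv i g x\<bar> \<le> L) \<and>
    (\<forall>x. (\<forall>y\<in>cball x e. f y = 0) \<longrightarrow> g x = 0)"
proof -
  have L: "L \<ge> 0" using lip[of 0 "axis undefined 1"] by (simp add: dist_norm)
  \<comment> \<open>The bound r \<le> e serves the support clause and L r \<le> e the uniform
    distance; L + 1 avoids dividing by 0 when L = 0.\<close>
  define r where "r = min e (e / (L + 1))"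
  have r: "r > 0" "r \<le> e" "L * r \<le> e"
  proof -
    show "r > 0" "r \<le> e" using e L by (auto simp: r_def)
    have "L * r \<le> (L + 1) * (e / (L + 1))" using L e by (intro mult_mono) (auto simp: r_def)
    then show "L * r \<le> e" using L by simp
  qed
  obtain \<rho> :: "real^'n \<Rightarrow> real" where \<rho>: "smooth \<rho>" "\<And>z. \<rho> z \<ge> 0" "\<And>z. norm z > r \<Longrightarrow> \<rho> z = 0"
    "integrable lborel \<rho>" "integral\<^sup>L lborel \<rho> = 1"
    using mollifier_exists[OF r(1)] by blast
  have "L-lipschitz_on UNIV f" using lip L by (intro lipschitz_onI) (auto simp: dist_real_def)
  then have f: "continuous_on UNIV f" by (rule lipschitz_on_continuous_on)
  let ?g = "conv f \<rho>"
  \<comment> \<open>After reflection x stands in the argument of f, so differences of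
    \<open>?g\<close> are averages of differences of f.\<close>
  have conv_eq: "?g x = (LINT z|lborel. f (x - z) * \<rho> z)" for x
    unfolding conv_def using lborel_integral_reflect[of "\<lambda>y. f y * \<rho> (x - y)" x] by simp
  have int: "integrable lborel (\<lambda>z. f (x - z) * \<rho> z)" for x
    by (rule compact_support_integrable[OF _ compact_cball[of 0 r]])
       (auto intro!: continuous_intros continuous_on_compose2[OF f] smooth_continuous[OF \<rho>(1)] simp: \<rho>(3))
  have bound: "\<bar>LINT z|lborel. h z * \<rho> z\<bar> \<le> c"
    if h: "integrable lborel (\<lambda>z. h z * \<rho> z)" "\<And>z. norm z \<le> r \<Longrightarrow> \<bar>h z\<bar> \<le> c" for h :: "real^'n \<Rightarrow> real" and c
  proof -
    have "\<bar>h z * \<rho> z\<bar> \<le> c * \<rho> z" for z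
      using h(2)[of z] \<rho>(2,3)[of z] by (cases "norm z \<le> r") (auto simp: abs_mult intro: mult_right_mono)
    then have "\<bar>LINT z|lborel. h z * \<rho> z\<bar> \<le> (LINT z|lborel. c * \<rho> z)"
      using Bochner_Integration.integral_norm_bound_integral[OF h(1), of "\<lambda>z. c * \<rho> z"] \<rho>(4) by simp
    then show ?thesis using \<rho>(5) by simp
  qed
  have "smooth ?g" by (rule smooth_conv[OF f \<rho>(1,3)])
  moreover have "\<bar>?g x - f x\<bar> \<le> e" for x
  proof -
    have "?g x - f x = (LINT z|lborel. f (x - z) * \<rho> z) - (LINT z|lborel. f x * \<rho> z)"
      using \<rho>(5) by (simp add: conv_eq)
    also have "\<dots> = (LINT z|lborel. (f (x - z) - f x) * \<rho> z)"
      using int \<rho>(4) by (subst Bochner_Integration.integral_diff[symmetric]) (auto simp: algebra_simps)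
    also have "\<bar>\<dots>\<bar> \<le> L * r"
    proof (rule bound)
      show "integrable lborel (\<lambda>z. (f (x - z) - f x) * \<rho> z)"
        using int[of x] \<rho>(4) by (simp add: left_diff_distrib)
      show "\<bar>f (x - z) - f x\<bar> \<le> L * r" if "norm z \<le> r" for z
        using lip[of "x - z" x] mult_left_mono[OF that L] by (simp add: dist_norm)
    qed
    finally show ?thesis using r(3) by simp
  qed
  moreover have "\<bar>partial_deriv i ?g x\<bar> \<le> L" for i x
  proof (rule partial_deriv_bound)
    show "?g differentiable (at x)" by (rule conv_derivative[OF f \<rho>(1,3)])
    fix y
    have "?g y - ?g x = (LINT z|lborel. (f (y - z) - f (x - z)) * \<rho> z)"
      using int by (subst conv_eq, subst conv_eq, subst Bochner_Integration.integral_diff[symmetric]) (auto simp: algebra_simps)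
    also have "\<bar>\<dots>\<bar> \<le> L * dist y x"
    proof (rule bound)
      show "integrable lborel (\<lambda>z. (f (y - z) - f (x - z)) * \<rho> z)"
        using int[of x] int[of y] by (simp add: left_diff_distrib)
      show "\<bar>f (y - z) - f (x - z)\<bar> \<le> L * dist y x" for z
        using lip[of "y - z" "x - z"] by (simp add: dist_norm)
    qed
    finally show "\<bar>?g y - ?g x\<bar> \<le> L * dist y x" .
  qed
  moreover have "?g x = 0" if "\<forall>y\<in>cball x e. f y = 0" for x
  proof -
    have "f (x - z) * \<rho> z = 0" for z
    proof (cases "norm z \<le> r")
      case True
      then have "x - z \<in> cball x e" using r(2) by (simp add: dist_norm)
      with that show ?thesis by simp
    qed (simp add: \<rho>(3))
    then have "(\<lambda>z. f (x - z) * \<rho> z) = (\<lambda>z. 0)" by (intro ext)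
    then show ?thesis unfolding conv_eq by (simp only: integral_zero)
  qed
  ultimately show ?thesis by blast
qed

text \<open>Difference quotients of f have integral 0 by translation invariance, and they converge
  to the partial derivative. The mean value theorem bounds them by a bound of the partial
  derivative, and as the steps are at most 1 they vanish outside the ball of radius |R| + 1; so the
  convergence is dominated.\<close>

lemma integral_partial_deriv_eq_0:
  fixes f :: "real^'n::finite \<Rightarrow> real"
  assumes f: "smooth f" and supp: "\<And>x. norm x > R \<Longrightarrow> f x = 0"
  shows "(LINT x|lborel. partial_deriv i f x) = 0"
proof -
  let ?p = "partial_deriv i f"
  define h where "h n = inverse (real (Suc n))" for n
  have h: "0 < h n" "h n \<le> 1" for n by (auto simp: h_def field_simps)
  have h0: "h \<longlonglongrightarrow> 0" unfolding h_def by (rule LIMSEQ_inverse_real_of_nat)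
  define q where "q n x = (f (x + h n *\<^sub>R axis i 1) - f x) / h n" for n x
  have cf: "continuous_on UNIV f" and cp: "continuous_on S ?p" for S
    using f by (auto intro: smooth_continuous smooth_partial_deriv)
  have D: "((\<lambda>t. f (x + t *\<^sub>R axis i 1)) has_field_derivative ?p (x + t *\<^sub>R axis i 1)) (at t)" for x t
  proof -
    have "((\<lambda>t. x + t *\<^sub>R axis i 1) has_derivative (\<lambda>t. t *\<^sub>R axis i 1)) (at t)"
      by (auto intro!: derivative_eq_intros)
    from has_derivative_compose[OF this has_derivative_partial[OF smooth_differentiable[OF f]]]
    have "((\<lambda>t. f (x + t *\<^sub>R axis i 1)) has_derivative
        (\<lambda>s. frechet_derivative f (at (x + t *\<^sub>R axis i 1)) (s *\<^sub>R axis i 1))) (at t)" .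
    moreover have "(\<lambda>s. frechet_derivative f (at (x + t *\<^sub>R axis i 1)) (s *\<^sub>R axis i 1)) =
        (\<lambda>s. ?p (x + t *\<^sub>R axis i 1) * s)"
      using linear_cmul[OF linear_frechet_derivative[OF smooth_differentiable[OF f]]]
      by (simp add: partial_deriv_def mult.commute)
    ultimately show ?thesis by (simp add: has_field_derivative_def)
  qed
  have "bounded (?p ` cball 0 \<bar>R\<bar>)"
    by (intro compact_imp_bounded compact_continuous_image cp compact_cball)
  then obtain M where M: "\<And>x. x \<in> cball 0 \<bar>R\<bar> \<Longrightarrow> \<bar>?p x\<bar> \<le> M"
    unfolding bounded_iff by (metis imageI real_norm_def)
  have M': "\<bar>?p x\<bar> \<le> \<bar>M\<bar>" for x
  proof (cases "norm x \<le> \<bar>R\<bar>")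
    case True then show ?thesis using M[of x] by simp
  next
    case False
    then have "?p x = 0" using supp by (intro partial_deriv_zero_outside_cball[of R]) auto
    then show ?thesis by simp
  qed
  have "(\<lambda>n. LINT x|lborel. q n x) \<longlonglongrightarrow> (LINT x|lborel. ?p x)"
  proof (rule integral_dominated_convergence[where w="\<lambda>x. \<bar>M\<bar> * indicator (cball 0 (\<bar>R\<bar> + 1)) x"])
    show "?p \<in> borel_measurable lborel" using borel_measurable_continuous_onI[OF cp] by simp
    have "f \<in> borel_measurable borel" using borel_measurable_continuous_onI[OF cf] by simp
    then show "q n \<in> borel_measurable lborel" for n unfolding q_def by measurable
    show "integrable lborel (\<lambda>x::real^'n. \<bar>M\<bar> * indicator (cball 0 (\<bar>R\<bar> + 1)) x)"
      by (intro integrable_mult_right integrable_real_indicator emeasure_bounded_finite) auto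
    show "AE x in lborel. (\<lambda>n. q n x) \<longlonglongrightarrow> ?p x"
    proof (rule AE_I2)
      fix x
      have "((\<lambda>t. (f (x + t *\<^sub>R axis i 1) - f x) / t) \<longlongrightarrow> ?p x) (at 0)"
        using D[of x 0] by (simp add: DERIV_def)
      moreover have "filterlim h (at 0) sequentially"
        using h0 h by (auto simp: filterlim_at intro!: always_eventually less_imp_neq[symmetric])
      ultimately show "(\<lambda>n. q n x) \<longlonglongrightarrow> ?p x" unfolding q_def by (rule filterlim_compose)
    qed
    show "AE x in lborel. norm (q n x) \<le> \<bar>M\<bar> * indicator (cball 0 (\<bar>R\<bar> + 1)) x" for n
    proof (rule AE_I2)
      fix x
      show "norm (q n x) \<le> \<bar>M\<bar> * indicator (cball 0 (\<bar>R\<bar> + 1)) x"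
      proof (cases "norm x \<le> \<bar>R\<bar> + 1")
        case True
        obtain t where "f (x + h n *\<^sub>R axis i 1) - f (x + 0 *\<^sub>R axis i 1) = (h n - 0) * ?p (x + t *\<^sub>R axis i 1)"
          using MVT2[OF h(1) D] by blast
        then have "q n x = ?p (x + t *\<^sub>R axis i 1)" using h(1)[of n] by (simp add: q_def)
        then show ?thesis using True M' by simp
      next
        case False
        have "norm (x + h n *\<^sub>R axis i 1) \<ge> norm x - norm (h n *\<^sub>R (axis i 1::real^'n))"
          by (rule norm_diff_ineq)
        moreover have "norm (h n *\<^sub>R (axis i 1::real^'n)) \<le> 1" using h[of n] by simp
        ultimately have "norm (x + h n *\<^sub>R axis i 1) > R" using False by linarith
        moreover have "norm x > R" using False by simp
        ultimately have "q n x = 0" using supp by (simp add: q_def)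
        then show ?thesis by simp
      qed
    qed
  qed
  moreover have "(LINT x|lborel. q n x) = 0" for n
  proof -
    have i: "integrable lborel f"
      by (rule compact_support_integrable[OF cf compact_cball[of 0 R]]) (use supp in auto)
    have "integrable lborel (\<lambda>x. f (x + h n *\<^sub>R axis i 1))"
    proof (rule compact_support_integrable[OF _ compact_cball[of "- h n *\<^sub>R axis i 1" R]])
      show "continuous_on UNIV (\<lambda>x. f (x + h n *\<^sub>R axis i 1))"
        by (intro continuous_on_compose2[OF cf] continuous_intros) auto
      show "f (x + h n *\<^sub>R axis i 1) = 0" if "x \<notin> cball (- h n *\<^sub>R axis i 1) R" for x
        using that by (intro supp) (simp add: dist_norm norm_minus_commute add.commute)
    qed
    then show ?thesis using i lborel_integral_translate[of f "h n *\<^sub>R axis i 1"] by (simp add: q_def)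
  qed
  ultimately show ?thesis using LIMSEQ_unique[of "\<lambda>n. 0::real"] by auto
qed

section \<open>The fundamental lemma of the calculus of variations\<close>

lemma test_functionsI:
  assumes "smooth \<psi>" "compact K" "K \<subseteq> B" "\<And>x. x \<notin> K \<Longrightarrow> \<psi> x = 0"
  shows "\<psi> \<in> test_functions B"
proof -
  have s: "closure {x. \<psi> x \<noteq> 0} \<subseteq> K"
    using assms(2,4) by (intro closure_minimal compact_imp_closed) auto
  then have "compact (closure {x. \<psi> x \<noteq> 0})"
    using assms(2) by (metis closed_closure compact_Int_closed inf.absorb_iff2)
  with s assms(1,3) show ?thesis unfolding test_functions_def smooth_def by auto
qed

lemma test_functionsE:
  assumes "\<psi> \<in> test_functions B"
  obtains K where "compact K" "K \<subseteq> B" "\<And>x. x \<notin> K \<Longrightarrow> \<psi> x = 0"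
proof
  show "compact (closure {x. \<psi> x \<noteq> 0})" "closure {x. \<psi> x \<noteq> 0} \<subseteq> B"
    using assms by (auto simp: test_functions_def)
  show "\<psi> x = 0" if "x \<notin> closure {x. \<psi> x \<noteq> 0}" for x
    using that closure_subset[of "{x. \<psi> x \<noteq> 0}"] by auto
qed

lemma test_functions_smooth: "\<psi> \<in> test_functions B \<Longrightarrow> smooth \<psi>"
  by (simp add: test_functions_def smooth_def)

lemma test_functions_mult_smooth:
  assumes "smooth f" "\<psi> \<in> test_functions B"
  shows "(\<lambda>x. f x * \<psi> x) \<in> test_functions B"
proof -
  obtain K where "compact K" "K \<subseteq> B" "\<And>x. x \<notin> K \<Longrightarrow> \<psi> x = 0"
    using assms(2) by (metis test_functionsE)
  then show ?thesis
    by (intro test_functionsI[of _ K] smooth_mult assms(1) test_functions_smooth[OF assms(2)]) auto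
qed

lemma partial_deriv_test_functions:
  assumes "\<psi> \<in> test_functions B"
  shows "partial_deriv i \<psi> \<in> test_functions B"
proof -
  obtain K where K: "compact K" "K \<subseteq> B" "\<And>x. x \<notin> K \<Longrightarrow> \<psi> x = 0"
    using assms by (metis test_functionsE)
  show ?thesis
  proof (rule test_functionsI[OF _ K(1,2)])
    show "smooth (partial_deriv i \<psi>)"
      using assms by (intro smooth_partial_deriv test_functions_smooth)
    show "partial_deriv i \<psi> x = 0" if "x \<notin> K" for x
      by (rule partial_deriv_zero_on_open[of "- K"]) (use that K in \<open>auto intro: compact_imp_closed\<close>)
  qed
qed

lemma open_in_sets_lebesgue: "open B \<Longrightarrow> B \<inter> space lebesgue \<in> sets lebesgue"
  by (simp add: borel_open)

lemma borel_measurable_lebesgue_on: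
  "f \<in> borel_measurable borel \<Longrightarrow> f \<in> borel_measurable (lebesgue_on B)"
  by (intro measurable_restrict_space1 measurable_completion) simp

lemma smooth_measurable_lebesgue_on: "smooth f \<Longrightarrow> f \<in> borel_measurable (lebesgue_on B)"
  by (intro borel_measurable_lebesgue_on borel_measurable_continuous_onI smooth_continuous)

lemma compact_subset_measurable:
  assumes "open B" "compact K" shows "(\<lambda>x. indicator K x :: real) \<in> borel_measurable (lebesgue_on B)"
  using assms by (intro borel_measurable_lebesgue_on borel_measurable_indicator borel_compact) 

lemma integral_lebesgue_on_eq_lborel:
  fixes f :: "real^'n::finite \<Rightarrow> real"
  assumes "open B" "f \<in> borel_measurable borel" "\<And>x. x \<notin> B \<Longrightarrow> f x = 0"
  shows "(LINT x|lebesgue_on B. f x) = (LINT x|lborel. f x)"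
proof -
  have "(\<lambda>x. indicator B x *\<^sub>R f x) = f" using assms(3) by (auto simp: indicator_def fun_eq_iff)
  then have "(LINT x|lebesgue_on B. f x) = (LINT x|lebesgue. f x)"
    using integral_restrict_space[OF open_in_sets_lebesgue[OF assms(1)], of f] by simp
  then show ?thesis using integral_completion[of f lborel] assms(2) by simp
qed

text \<open>Integration by parts without boundary term; it is what gives constants the weak gradient
  0.\<close>

lemma test_function_integral_partial_deriv:
  assumes "open B" "\<psi> \<in> test_functions B"
  shows "(LINT x|lebesgue_on B. partial_deriv i \<psi> x) = 0"
proof -
  have p: "partial_deriv i \<psi> \<in> test_functions B" using assms(2) by (rule partial_deriv_test_functions)
  obtain K where K: "compact K" "K \<subseteq> B" "\<And>x. x \<notin> K \<Longrightarrow> \<psi> x = 0"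
    using assms(2) by (metis test_functionsE)
  obtain K' where K': "K' \<subseteq> B" "\<And>x. x \<notin> K' \<Longrightarrow> partial_deriv i \<psi> x = 0"
    using p by (metis test_functionsE)
  obtain R where R: "\<And>x. x \<in> K \<Longrightarrow> norm x \<le> R"
    using compact_imp_bounded[OF K(1)] unfolding bounded_iff by blast
  have "(LINT x|lborel. partial_deriv i \<psi> x) = 0"
    by (rule integral_partial_deriv_eq_0[OF test_functions_smooth[OF assms(2)], of R]) (meson R K(3) not_le)
  moreover have "(LINT x|lebesgue_on B. partial_deriv i \<psi> x) = (LINT x|lborel. partial_deriv i \<psi> x)"
    by (rule integral_lebesgue_on_eq_lborel[OF assms(1)
          borel_measurable_continuous_onI[OF smooth_continuous[OF test_functions_smooth[OF p]]]])
       (use K' in blast)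
  ultimately show ?thesis by simp
qed

section \<open>Local integrability\<close>

definition locally_integrable_on :: "(real^'n::finite) set \<Rightarrow> (real^'n \<Rightarrow> 'b::euclidean_space) \<Rightarrow> bool" where
  "locally_integrable_on B f \<longleftrightarrow> (\<forall>K. compact K \<and> K \<subseteq> B \<longrightarrow> f absolutely_integrable_on K)"

lemma absolutely_integrable_on_iff_lebesgue_on:
  assumes "open B" "K \<subseteq> B"
  shows "f absolutely_integrable_on K \<longleftrightarrow> integrable (lebesgue_on B) (\<lambda>x. indicator K x *\<^sub>R f x)"
proof -
  have "(\<lambda>x. indicator B x *\<^sub>R indicator K x *\<^sub>R f x) = (\<lambda>x. indicator K x *\<^sub>R f x)"
    using assms(2) by (auto simp: indicator_def fun_eq_iff)
  then show ?thesis
    by (simp add: integrable_restrict_space[OF open_in_sets_lebesgue[OF assms(1)]] set_integrable_def)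
qed

lemma compact_exhaustion:
  fixes B :: "(real^'n::finite) set"
  assumes "open B"
  obtains K :: "nat \<Rightarrow> (real^'n) set" where "\<And>n. compact (K n)" "\<And>n. K n \<subseteq> B"
    "\<And>x. x \<in> B \<Longrightarrow> eventually (\<lambda>n. x \<in> K n) sequentially"
proof -
  obtain K :: "nat \<Rightarrow> (real^'n) set" where K: "\<And>n. compact (K n)" "\<And>n. K n \<subseteq> B"
    "\<And>n. K n \<subseteq> interior (K (Suc n))" "\<Union>(range K) = B"
    using open_Union_compact_subsets[OF assms] by metis
  have "K n \<subseteq> K (Suc n)" for n using K(3) interior_subset by blast
  then have m: "m \<le> n \<Longrightarrow> K m \<subseteq> K n" for m n by (rule lift_Suc_mono_le)
  have "eventually (\<lambda>n. x \<in> K n) sequentially" if "x \<in> B" for x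
  proof -
    from that K(4) have "x \<in> (\<Union>n. K n)" by simp
    then obtain m0 where "x \<in> K m0" by (elim UN_E)
    then have "x \<in> K n" if "m0 \<le> n" for n using m[OF that] by (rule subsetD[rotated])
    then show ?thesis by (auto simp: eventually_sequentially)
  qed
  then show ?thesis by (rule that[OF K(1,2)])
qed

text \<open>On B the function is the pointwise limit of its truncations to a compact exhaustion,
  each of which is integrable.\<close>

lemma locally_integrable_on_measurable:
  fixes f :: "real^'n::finite \<Rightarrow> 'b::euclidean_space"
  assumes "open B" "locally_integrable_on B f"
  shows "f \<in> borel_measurable (lebesgue_on B)"
proof -
  obtain K where K: "\<And>n. compact (K n)" "\<And>n. K n \<subseteq> B"
    "\<And>x. x \<in> B \<Longrightarrow> eventually (\<lambda>n. x \<in> K n) sequentially"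
    using compact_exhaustion[OF assms(1)] by blast
  show ?thesis
  proof (rule borel_measurable_LIMSEQ_metric)
    show "(\<lambda>x. indicator (K n) x *\<^sub>R f x) \<in> borel_measurable (lebesgue_on B)" for n
    proof -
      have "f absolutely_integrable_on K n"
        using assms(2) K(1,2) unfolding locally_integrable_on_def by simp
      then show ?thesis
        unfolding absolutely_integrable_on_iff_lebesgue_on[OF assms(1) K(2)]
        by (rule borel_measurable_integrable)
    qed
    show "(\<lambda>n. indicator (K n) x *\<^sub>R f x) \<longlonglongrightarrow> f x" if "x \<in> space (lebesgue_on B)" for x
      by (rule tendsto_eventually, rule eventually_mono[OF K(3)]) (use that in auto)
  qed
qed

lemma locally_integrable_on_mult_integrable:
  assumes B: "open B" and g: "locally_integrable_on B g" and K: "compact K" "K \<subseteq> B"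
    and c: "continuous_on UNIV \<psi>" "\<And>x. x \<notin> K \<Longrightarrow> \<psi> x = 0"
  shows "integrable (lebesgue_on B) (\<lambda>x. g x * \<psi> x :: real)"
proof -
  have "bounded (\<psi> ` K)"
    by (intro compact_imp_bounded compact_continuous_image continuous_on_subset[OF c(1)] K) simp
  then obtain M where M: "\<And>x. x \<in> K \<Longrightarrow> \<bar>\<psi> x\<bar> \<le> M"
    unfolding bounded_iff by (metis imageI real_norm_def)
  have i: "integrable (lebesgue_on B) (\<lambda>x. indicator K x *\<^sub>R g x)"
    using g K absolutely_integrable_on_iff_lebesgue_on[OF B K(2), of g] by (auto simp: locally_integrable_on_def)
  show ?thesis
  proof (rule Bochner_Integration.integrable_bound[OF integrable_mult_right[OF i, of M]])
    show "(\<lambda>x. g x * \<psi> x) \<in> borel_measurable (lebesgue_on B)"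
      by (intro borel_measurable_times locally_integrable_on_measurable[OF B g]
          borel_measurable_lebesgue_on borel_measurable_continuous_onI c(1))
    have "norm (g x * \<psi> x) \<le> norm (M * (indicator K x *\<^sub>R g x))" for x
    proof (cases "x \<in> K")
      case True
      then have "\<bar>\<psi> x\<bar> \<le> \<bar>M\<bar>" using M[of x] by simp
      from mult_left_mono[OF this abs_ge_zero[of "g x"]] show ?thesis using True by (simp add: abs_mult mult.commute)
    qed (use c(2) in auto)
    then show "AE x in lebesgue_on B. norm (g x * \<psi> x) \<le> norm (M * (indicator K x *\<^sub>R g x))" by simp
  qed
qed

lemma test_mult_integrable:
  assumes "open B" "locally_integrable_on B g" "\<psi> \<in> test_functions B"
  shows "integrable (lebesgue_on B) (\<lambda>x. g x * \<psi> x :: real)"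
proof -
  obtain K where "compact K" "K \<subseteq> B" "\<And>x. x \<notin> K \<Longrightarrow> \<psi> x = 0"
    using assms(3) by (metis test_functionsE)
  then show ?thesis
    by (rule locally_integrable_on_mult_integrable[OF assms(1,2) _ _ smooth_continuous[OF test_functions_smooth[OF assms(3)]]])
qed

text \<open>The indicator of K is a pointwise limit of test functions obtained by smoothing
  Lipschitz cutoffs. All of them are supported in one compact neighbourhood of K inside B, which
  makes the convergence dominated.\<close>

lemma integral_over_compact_eq_0:
  fixes g :: "real^'n::finite \<Rightarrow> real"
  assumes B: "open B" and g: "locally_integrable_on B g"
    and z: "\<And>\<psi>. \<psi> \<in> test_functions B \<Longrightarrow> (LINT x|lebesgue_on B. g x * \<psi> x) = 0"
    and K: "compact K" "K \<subseteq> B"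
  shows "(LINT x|lebesgue_on B. g x * indicator K x) = 0"
proof (cases "K = {}")
  case False
  obtain e where e: "e > 0" "{x. infdist x K \<le> e} \<subseteq> B"
    using compact_in_open_separated[OF False K(1) B K(2)] by blast
  let ?K = "{x. infdist x K \<le> e}"
  have K': "compact ?K" using compact_infdist_le[OF False K(1) e(1)] .
  \<comment> \<open>Starting the index at N keeps 1 / \<open>k n\<close> below e / 2: the cutoff
    spreads K by 1 / \<open>k n\<close> and smoothing spreads it by another 1 / \<open>k n\<close>,
    so supports stay within distance e of K.\<close>
  obtain N where N: "real (Suc N) \<ge> 2 / e" by (meson real_arch_simple order_trans of_nat_mono le_SucI order_refl)
  define k where "k n = real (Suc (n + N))" for n
  have k: "k n > 0" "1 / k n \<le> e / 2" "k n \<ge> 1" for n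
  proof -
    show "k n > 0" "k n \<ge> 1" by (auto simp: k_def)
    have "2 / e \<le> k n" using N by (simp add: k_def)
    then show "1 / k n \<le> e / 2" using \<open>k n > 0\<close> e(1) by (simp add: field_simps)
  qed
  define v where "v n x = max 0 (1 - k n * infdist x K)" for n x
  have lip: "\<bar>v n x - v n y\<bar> \<le> k n * dist x y" for n x y
  proof -
    have "\<bar>v n x - v n y\<bar> \<le> \<bar>k n * (infdist x K - infdist y K)\<bar>"
      unfolding right_diff_distrib v_def by linarith
    also have "\<dots> \<le> k n * dist x y"
      using infdist_triangle_abs[of x K y] k(1)[of n] by (simp add: abs_mult)
    finally show ?thesis .
  qed
  have "\<exists>\<psi>. smooth \<psi> \<and> (\<forall>x. \<bar>\<psi> x - v n x\<bar> \<le> 1 / k n) \<and> (\<forall>x. x \<notin> ?K \<longrightarrow> \<psi> x = 0)" for n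
  proof -
    obtain \<psi> where \<psi>: "smooth \<psi>" "\<And>x. \<bar>\<psi> x - v n x\<bar> \<le> 1 / k n"
      "\<And>x. (\<And>y. y \<in> cball x (1 / k n) \<Longrightarrow> v n y = 0) \<Longrightarrow> \<psi> x = 0"
      using lipschitz_smooth_approx[OF lip, of "1 / k n" n] k(1)[of n] by (auto simp: Ball_def)
    have "\<psi> x = 0" if "x \<notin> ?K" for x
    proof (rule \<psi>(3))
      fix y assume "y \<in> cball x (1 / k n)"
      then have "dist x y \<le> e / 2" using k(2)[of n] by simp
      then have "infdist y K \<ge> 1 / k n" using infdist_triangle[of x K y] that k(2)[of n] by simp
      then have "k n * infdist y K \<ge> 1" using k(1)[of n] by (simp add: field_simps)
      then show "v n y = 0" by (simp add: v_def)
    qed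
    with \<psi>(1,2) show ?thesis by blast
  qed
  then obtain \<psi> where \<psi>: "\<And>n. smooth (\<psi> n)" "\<And>n x. \<bar>\<psi> n x - v n x\<bar> \<le> 1 / k n"
    "\<And>n x. x \<notin> ?K \<Longrightarrow> \<psi> n x = 0" by metis
  have test: "\<psi> n \<in> test_functions B" for n
    by (rule test_functionsI[OF \<psi>(1) K' e(2) \<psi>(3)])
  have k_lim: "(\<lambda>n. 1 / k n) \<longlonglongrightarrow> 0"
    using LIMSEQ_ignore_initial_segment[OF LIMSEQ_inverse_real_of_nat, of N] by (simp add: k_def inverse_eq_divide)
  have lim: "(\<lambda>n. \<psi> n x) \<longlonglongrightarrow> indicator K x" for x
  proof -
    have "(\<lambda>n. v n x) \<longlonglongrightarrow> indicator K x"
    proof (cases "x \<in> K")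
      case True then show ?thesis by (simp add: v_def)
    next
      case False
      then have pos: "infdist x K > 0"
        using \<open>K \<noteq> {}\<close> K(1) in_closed_iff_infdist_zero[OF compact_imp_closed] infdist_nonneg[of x K]
        by (metis less_eq_real_def)
      have "eventually (\<lambda>n. 1 / k n < infdist x K) sequentially"
        using k_lim pos by (rule order_tendstoD)
      then have "eventually (\<lambda>n. v n x = 0) sequentially"
      proof eventually_elim
        case (elim n)
        then show ?case using k(1)[of n] by (simp add: v_def field_simps)
      qed
      then show ?thesis using False by (simp add: tendsto_eventually)
    qed
    moreover have "(\<lambda>n. \<psi> n x - v n x) \<longlonglongrightarrow> 0"
      by (rule Lim_null_comparison[OF _ k_lim]) (use \<psi>(2) in auto)
    ultimately show ?thesis using tendsto_add by fastforce
  qed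
  have i: "integrable (lebesgue_on B) (\<lambda>x. indicator ?K x *\<^sub>R g x)"
    using g K' e(2) absolutely_integrable_on_iff_lebesgue_on[OF B e(2), of g] by (auto simp: locally_integrable_on_def)
  have "(\<lambda>n. LINT x|lebesgue_on B. g x * \<psi> n x) \<longlonglongrightarrow> (LINT x|lebesgue_on B. g x * indicator K x)"
  proof (rule integral_dominated_convergence[where w="\<lambda>x. 2 * norm (indicator ?K x *\<^sub>R g x)"])
    have gm: "g \<in> borel_measurable (lebesgue_on B)" by (rule locally_integrable_on_measurable[OF B g])
    then show "(\<lambda>x. g x * indicator K x) \<in> borel_measurable (lebesgue_on B)"
      by (intro borel_measurable_times compact_subset_measurable B K)
    show "(\<lambda>x. g x * \<psi> n x) \<in> borel_measurable (lebesgue_on B)" for n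
      by (intro borel_measurable_times gm smooth_measurable_lebesgue_on \<psi>(1))
    show "integrable (lebesgue_on B) (\<lambda>x. 2 * norm (indicator ?K x *\<^sub>R g x))"
      by (intro integrable_mult_right integrable_norm i)
    show "AE x in lebesgue_on B. (\<lambda>n. g x * \<psi> n x) \<longlonglongrightarrow> g x * indicator K x"
      by (intro AE_I2 tendsto_mult tendsto_const lim)
    show "AE x in lebesgue_on B. norm (g x * \<psi> n x) \<le> 2 * norm (indicator ?K x *\<^sub>R g x)" for n
    proof (rule AE_I2)
      fix x
      \<comment> \<open>The cutoff lies in [0, 1] and smoothing moves it by at most 1 /
        \<open>k n\<close> \<le> 1, whence the factor 2 in the dominating function.\<close>
      have v: "0 \<le> v n x" "v n x \<le> 1" using k(1)[of n] infdist_nonneg[of x K] by (auto simp: v_def)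
      have "1 / k n \<le> 1" using k(3)[of n] by simp
      then have "\<bar>\<psi> n x\<bar> \<le> 2" using \<psi>(2)[of n x] v by linarith
      from mult_left_mono[OF this abs_ge_zero[of "g x"]]
      show "norm (g x * \<psi> n x) \<le> 2 * norm (indicator ?K x *\<^sub>R g x)"
        using \<psi>(3)[of x n] by (cases "x \<in> ?K") (auto simp: abs_mult)
    qed
  qed
  then show ?thesis using z[OF test] LIMSEQ_unique[of "\<lambda>n. 0::real"] by auto
qed simp

text \<open>A compact set on which g > 0 and over which g has integral 0 is null. By inner
  regularity the part of {g > 0} in any compact subset of B is then null, and countably many such
  subsets exhaust B.\<close>

lemma AE_not_pos_of_integral_over_compact_eq_0:
  fixes g :: "real^'n::finite \<Rightarrow> real"
  assumes B: "open B" and g: "locally_integrable_on B g"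
    and z: "\<And>K. compact K \<Longrightarrow> K \<subseteq> B \<Longrightarrow> (LINT x|lebesgue_on B. g x * indicator K x) = 0"
  shows "AE x in lebesgue_on B. \<not> g x > 0"
proof -
  have null: "T \<in> null_sets lebesgue" if T: "compact T" "T \<subseteq> B" "\<And>x. x \<in> T \<Longrightarrow> g x > 0" for T
  proof -
    have i: "integrable (lebesgue_on B) (\<lambda>x. indicator T x *\<^sub>R g x)"
      using g T absolutely_integrable_on_iff_lebesgue_on[OF B T(2), of g] by (auto simp: locally_integrable_on_def)
    have "(LINT x|lebesgue_on B. indicator T x *\<^sub>R g x) = 0"
      using z[OF T(1,2)] by (simp add: mult.commute)
    moreover have "AE x in lebesgue_on B. 0 \<le> indicator T x *\<^sub>R g x"
      using T(3) by (intro AE_I2) (auto simp: indicator_def less_imp_le)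
    ultimately have "AE x in lebesgue_on B. indicator T x *\<^sub>R g x = 0"
      using integral_nonneg_eq_0_iff_AE[OF i] by blast
    then have "AE x in lebesgue. x \<in> B \<longrightarrow> indicator T x *\<^sub>R g x = 0"
      by (simp add: AE_restrict_space_iff[OF open_in_sets_lebesgue[OF B]])
    then have "AE x in lebesgue. x \<notin> T"
      by eventually_elim (use T(2,3) in \<open>fastforce simp: indicator_def\<close>)
    moreover have "T \<in> sets lebesgue" using T(1) by (simp add: borel_compact)
    ultimately show ?thesis by (simp add: AE_iff_null_sets)
  qed
  have compact_case: "AE x in lebesgue. x \<notin> {x \<in> K. g x > 0}" if K: "compact K" "K \<subseteq> B" for K
  proof -
    let ?S = "{x \<in> K. g x > 0}"
    have "{x \<in> space (lebesgue_on B). g x > 0} \<in> sets (lebesgue_on B)"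
      using locally_integrable_on_measurable[OF B g] by measurable
    then have "{x \<in> B. g x > 0} \<in> sets lebesgue"
      using B by (auto simp: sets_restrict_space_iff)
    then have "{x \<in> B. g x > 0} \<inter> K \<in> sets lebesgue" using K(1) by (intro sets.Int) (auto simp: borel_compact)
    moreover have "{x \<in> B. g x > 0} \<inter> K = ?S" using K(2) by auto
    ultimately have S: "?S \<in> sets lebesgue" by simp
    have le: "emeasure lebesgue ?S \<le> ennreal e" if "e > 0" for e :: real
    proof -
      obtain T where T: "closed T" "T \<subseteq> ?S" "emeasure lebesgue (?S - T) < ennreal e"
        by (rule sets_lebesgue_inner_closed[OF S \<open>e > 0\<close>])
      have "T \<subseteq> K" using T(2) by auto
      then have "compact T" using K(1) T(1) by (metis compact_Int_closed inf.absorb_iff2)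
      with T(2) K(2) have "T \<in> null_sets lebesgue" by (intro null) auto
      then have "emeasure lebesgue (?S - T) = emeasure lebesgue ?S" by (rule emeasure_Diff_null_set[OF _ S])
      with T(3) show ?thesis by simp
    qed
    have "emeasure lebesgue ?S \<le> 0"
      by (rule ennreal_le_epsilon) (use le in auto)
    then have "?S \<in> null_sets lebesgue" using S by (auto simp: null_sets_def)
    then show ?thesis by (rule AE_not_in)
  qed
  obtain K where K: "\<And>n. compact (K n)" "\<And>n. K n \<subseteq> B"
    "\<And>x. x \<in> B \<Longrightarrow> eventually (\<lambda>n. x \<in> K n) sequentially"
    using compact_exhaustion[OF B] by blast
  have "AE x in lebesgue. \<forall>n. x \<notin> {x \<in> K n. g x > 0}"
    unfolding AE_all_countable using compact_case[OF K(1,2)] by blast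
  then have "AE x in lebesgue. x \<in> B \<longrightarrow> \<not> g x > 0"
  proof eventually_elim
    case (elim x)
    show ?case
    proof
      assume "x \<in> B"
      then obtain n where "x \<in> K n" using K(3)[of x] eventually_happens'[OF sequentially_bot] by blast
      with elim show "\<not> g x > 0" by auto
    qed
  qed
  then show ?thesis by (simp add: AE_restrict_space_iff[OF open_in_sets_lebesgue[OF B]])
qed

lemma fundamental_lemma:
  fixes g :: "real^'n::finite \<Rightarrow> real"
  assumes B: "open B" and g: "locally_integrable_on B g"
    and z: "\<And>\<psi>. \<psi> \<in> test_functions B \<Longrightarrow> (LINT x|lebesgue_on B. g x * \<psi> x) = 0"
  shows "AE x in lebesgue_on B. g x = 0"
proof -
  have *: "(LINT x|lebesgue_on B. g x * indicator K x) = 0" if "compact K" "K \<subseteq> B" for K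
    by (rule integral_over_compact_eq_0[OF B g z that])
  have "AE x in lebesgue_on B. \<not> g x > 0"
    by (rule AE_not_pos_of_integral_over_compact_eq_0[OF B g *])
  moreover have "AE x in lebesgue_on B. \<not> - g x > 0"
  proof (rule AE_not_pos_of_integral_over_compact_eq_0[OF B])
    show "locally_integrable_on B (\<lambda>x. - g x)"
      using g by (simp add: locally_integrable_on_def set_integrable_def)
  qed (use * in simp)
  ultimately show ?thesis by eventually_elim simp
qed

section \<open>Weak gradients\<close>

definition grad :: "(real^'n::finite \<Rightarrow> real) \<Rightarrow> real^'n \<Rightarrow> real^'n" where
  "grad f x = (\<chi> i. partial_deriv i f x)"

lemma grad_nth [simp]: "grad f x $ i = partial_deriv i f x"
  by (simp add: grad_def)

lemma grad_measurable: "smooth f \<Longrightarrow> grad f \<in> borel_measurable (lebesgue_on B)"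
  unfolding grad_def
  by (intro borel_measurable_lebesgue_on borel_measurable_continuous_onI continuous_on_vec_lambda
      smooth_continuous smooth_partial_deriv)

lemma has_weak_gradient_iff:
  "has_weak_gradient B u G \<longleftrightarrow> locally_integrable_on B u \<and> locally_integrable_on B G \<and>
     (\<forall>\<psi>\<in>test_functions B. \<forall>i. (LINT x|lebesgue_on B. u x * partial_deriv i \<psi> x)
        = - (LINT x|lebesgue_on B. G x $ i * \<psi> x))"
  unfolding has_weak_gradient_def locally_integrable_on_def by blast

lemma locally_integrable_on_nth:
  "locally_integrable_on B G \<Longrightarrow> locally_integrable_on B (\<lambda>x. G x $ i)"
  unfolding locally_integrable_on_def set_integrable_def
  using integrable_bounded_linear[OF bounded_linear_vec_nth[of i], of lebesgue "\<lambda>x. indicator K x *\<^sub>R G x" for K]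
  by simp

lemma locally_integrable_on_add:
  "locally_integrable_on B f \<Longrightarrow> locally_integrable_on B g \<Longrightarrow> locally_integrable_on B (\<lambda>x. f x + g x)"
  unfolding locally_integrable_on_def using set_integral_add(1) by blast

lemma locally_integrable_on_diff:
  "locally_integrable_on B f \<Longrightarrow> locally_integrable_on B g \<Longrightarrow> locally_integrable_on B (\<lambda>x. f x - g x)"
  unfolding locally_integrable_on_def using set_integral_diff(1) by blast

lemma locally_integrable_on_bound:
  assumes B: "open B" and f: "locally_integrable_on B f" and g: "g \<in> borel_measurable (lebesgue_on B)"
    and le: "AE x in lebesgue_on B. norm (g x) \<le> M * norm (f x)"
  shows "locally_integrable_on B g"
  unfolding locally_integrable_on_def
proof (intro allI impI)
  fix K assume K: "compact K \<and> K \<subseteq> B"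
  have i: "integrable (lebesgue_on B) (\<lambda>x. indicator K x *\<^sub>R f x)"
    using f K absolutely_integrable_on_iff_lebesgue_on[OF B, of K f] by (auto simp: locally_integrable_on_def)
  show "g absolutely_integrable_on K"
    unfolding absolutely_integrable_on_iff_lebesgue_on[OF B K[THEN conjunct2]]
  proof (rule Bochner_Integration.integrable_bound[OF integrable_scaleR_right[OF i, of M]])
    show "(\<lambda>x. indicator K x *\<^sub>R g x) \<in> borel_measurable (lebesgue_on B)"
      using K by (intro borel_measurable_scaleR g compact_subset_measurable B) auto
    show "AE x in lebesgue_on B. norm (indicator K x *\<^sub>R g x) \<le> norm (M *\<^sub>R indicator K x *\<^sub>R f x)"
      using le
    proof eventually_elim
      case (elim x)
      also have "M * norm (f x) \<le> \<bar>M\<bar> * norm (f x)" by (intro mult_right_mono) auto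
      finally show ?case by (auto simp: indicator_def)
    qed
  qed
qed

lemma continuous_locally_integrable_on:
  assumes "continuous_on UNIV f"
  shows "locally_integrable_on B f"
  unfolding locally_integrable_on_def set_integrable_def
proof (intro allI impI)
  fix K assume "compact K \<and> K \<subseteq> B"
  then have "integrable lborel (\<lambda>x. indicator K x *\<^sub>R f x)"
    by (intro borel_integrable_compact continuous_on_subset[OF assms]) auto
  then show "integrable lebesgue (\<lambda>x. indicator K x *\<^sub>R f x)"
    by (simp add: integrable_completion)
qed

lemma smooth_locally_integrable_on: "smooth f \<Longrightarrow> locally_integrable_on B f"
  by (intro continuous_locally_integrable_on smooth_continuous)

text \<open>Componentwise, the difference of two weak gradients integrates to 0 against every test
  function, so \<open>fundamental_lemma\<close> applies.\<close>

lemma has_weak_gradient_unique: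
  assumes B: "open B" and "has_weak_gradient B u G" "has_weak_gradient B u H"
  shows "AE x in lebesgue_on B. G x = H x"
proof -
  have G: "locally_integrable_on B (\<lambda>x. G x $ i)" and H: "locally_integrable_on B (\<lambda>x. H x $ i)" for i
    using assms by (auto simp: has_weak_gradient_iff intro: locally_integrable_on_nth)
  have "AE x in lebesgue_on B. G x $ i - H x $ i = 0" for i
  proof (rule fundamental_lemma[OF B locally_integrable_on_diff[OF G H]])
    fix \<psi> assume \<psi>: "\<psi> \<in> test_functions B"
    have "(LINT x|lebesgue_on B. G x $ i * \<psi> x) = (LINT x|lebesgue_on B. H x $ i * \<psi> x)"
      using assms(2,3) \<psi> by (force simp: has_weak_gradient_iff)
    then show "(LINT x|lebesgue_on B. (G x $ i - H x $ i) * \<psi> x) = 0"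
      using test_mult_integrable[OF B G \<psi>] test_mult_integrable[OF B H \<psi>]
      by (simp add: left_diff_distrib)
  qed
  then have "AE x in lebesgue_on B. \<forall>i\<in>UNIV. G x $ i - H x $ i = 0"
    by (intro AE_finite_allI) auto
  then show ?thesis by eventually_elim (simp add: vec_eq_iff)
qed

lemma has_weak_gradient_weak_grad:
  "has_weak_gradient B u G \<Longrightarrow> has_weak_gradient B u (weak_grad B u)"
  unfolding weak_grad_def using someI[of "has_weak_gradient B u"] by simp

lemma weak_grad_AE_eq:
  "open B \<Longrightarrow> has_weak_gradient B u G \<Longrightarrow> AE x in lebesgue_on B. weak_grad B u x = G x"
  using has_weak_gradient_unique has_weak_gradient_weak_grad by blast

lemma has_weak_gradient_measurable:
  "open B \<Longrightarrow> has_weak_gradient B u G \<Longrightarrow> G \<in> borel_measurable (lebesgue_on B)"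
  by (simp add: has_weak_gradient_iff locally_integrable_on_measurable)

lemma has_weak_gradient_diff:
  assumes B: "open B" and u: "has_weak_gradient B u G" and v: "has_weak_gradient B v H"
  shows "has_weak_gradient B (\<lambda>x. u x - v x) (\<lambda>x. G x - H x)"
  unfolding has_weak_gradient_iff
proof (intro conjI ballI allI)
  have l: "locally_integrable_on B u" "locally_integrable_on B v" "locally_integrable_on B G" "locally_integrable_on B H"
    using u v by (auto simp: has_weak_gradient_iff)
  show "locally_integrable_on B (\<lambda>x. u x - v x)" "locally_integrable_on B (\<lambda>x. G x - H x)"
    by (intro locally_integrable_on_diff l)+
  fix \<psi> i assume \<psi>: "\<psi> \<in> test_functions B"
  note p = partial_deriv_test_functions[OF \<psi>, of i]
  have "(LINT x|lebesgue_on B. (u x - v x) * partial_deriv i \<psi> x) =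
      (LINT x|lebesgue_on B. u x * partial_deriv i \<psi> x) - (LINT x|lebesgue_on B. v x * partial_deriv i \<psi> x)"
    using test_mult_integrable[OF B l(1) p] test_mult_integrable[OF B l(2) p] by (simp add: left_diff_distrib)
  also have "\<dots> = - ((LINT x|lebesgue_on B. G x $ i * \<psi> x) - (LINT x|lebesgue_on B. H x $ i * \<psi> x))"
    using u v \<psi> by (simp add: has_weak_gradient_iff)
  also have "\<dots> = - (LINT x|lebesgue_on B. (G x - H x) $ i * \<psi> x)"
    using test_mult_integrable[OF B locally_integrable_on_nth[OF l(3)] \<psi>]
      test_mult_integrable[OF B locally_integrable_on_nth[OF l(4)] \<psi>] by (simp add: left_diff_distrib)
  finally show "(LINT x|lebesgue_on B. (u x - v x) * partial_deriv i \<psi> x) = - (LINT x|lebesgue_on B. (G x - H x) $ i * \<psi> x)" .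
qed

text \<open>The seed for the product rules: with the constant 1 as second factor they yield the weak
  gradients of smooth functions and of \<phi>.\<close>

lemma has_weak_gradient_const:
  fixes B :: "(real^'n::finite) set"
  assumes B: "open B"
  shows "has_weak_gradient B (\<lambda>x. c) (\<lambda>x. 0)"
  unfolding has_weak_gradient_iff
proof (intro conjI ballI allI)
  show "locally_integrable_on B (\<lambda>x. c)" by (intro smooth_locally_integrable_on smooth_const)
  show "locally_integrable_on B (\<lambda>x. 0::real^'n)" by (auto simp: locally_integrable_on_def set_integrable_def)
  fix \<psi> :: "real^'n \<Rightarrow> real" and i assume "\<psi> \<in> test_functions B"
  then show "(LINT x|lebesgue_on B. c * partial_deriv i \<psi> x) = - (LINT x|lebesgue_on B. 0 $ i * \<psi> x)"
    using test_function_integral_partial_deriv[OF B] by simp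
qed

text \<open>Multiplying a test function by f gives a test function again. Testing the weak gradient
  of u with \<open>f x * \<psi> x\<close> and expanding the partial derivative of this product gives
  the formula.\<close>

lemma weak_product_rule_smooth:
  assumes B: "open B" and f: "smooth f" and u: "has_weak_gradient B u G"
  and \<psi>: "\<psi> \<in> test_functions B"
  shows "(LINT x|lebesgue_on B. f x * u x * partial_deriv i \<psi> x) =
      - (LINT x|lebesgue_on B. (f x * G x $ i + u x * partial_deriv i f x) * \<psi> x)"
proof -
  have l: "locally_integrable_on B u" "locally_integrable_on B (\<lambda>x. G x $ i)"
    using u by (auto simp: has_weak_gradient_iff intro: locally_integrable_on_nth)
  have t: "(\<lambda>x. f x * \<psi> x) \<in> test_functions B" "(\<lambda>x. f x * partial_deriv i \<psi> x) \<in> test_functions B"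
    "(\<lambda>x. partial_deriv i f x * \<psi> x) \<in> test_functions B"
    by (intro test_functions_mult_smooth f \<psi> partial_deriv_test_functions smooth_partial_deriv)+
  note int = test_mult_integrable[OF B l(1) t(2)] test_mult_integrable[OF B l(1) t(3)] test_mult_integrable[OF B l(2) t(1)]
  have "(LINT x|lebesgue_on B. u x * partial_deriv i (\<lambda>x. f x * \<psi> x) x) = - (LINT x|lebesgue_on B. G x $ i * (f x * \<psi> x))"
    using u t(1) by (simp add: has_weak_gradient_iff)
  moreover have "partial_deriv i (\<lambda>x. f x * \<psi> x) x = f x * partial_deriv i \<psi> x + partial_deriv i f x * \<psi> x" for x
    by (intro partial_deriv_mult smooth_differentiable f test_functions_smooth[OF \<psi>])
  ultimately have "(LINT x|lebesgue_on B. u x * (f x * partial_deriv i \<psi> x)) + (LINT x|lebesgue_on B. u x * (partial_deriv i f x * \<psi> x))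
     = - (LINT x|lebesgue_on B. G x $ i * (f x * \<psi> x))"
    using int by (simp add: distrib_left)
  then have "(LINT x|lebesgue_on B. u x * (f x * partial_deriv i \<psi> x)) =
     - ((LINT x|lebesgue_on B. G x $ i * (f x * \<psi> x)) + (LINT x|lebesgue_on B. u x * (partial_deriv i f x * \<psi> x)))"
    by simp
  also have "\<dots> = - (LINT x|lebesgue_on B. G x $ i * (f x * \<psi> x) + u x * (partial_deriv i f x * \<psi> x))"
    using int by simp
  finally show ?thesis by (simp add: algebra_simps)
qed

lemma has_weak_gradient_smooth:
  assumes B: "open B" and f: "smooth f"
  shows "has_weak_gradient B f (grad f)"
  unfolding has_weak_gradient_iff
proof (intro conjI ballI allI)
  show "locally_integrable_on B f" by (intro smooth_locally_integrable_on f)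
  show "locally_integrable_on B (grad f)"
    unfolding grad_def
    by (intro continuous_locally_integrable_on continuous_on_vec_lambda smooth_continuous
        smooth_partial_deriv f)
  fix \<psi> i assume "\<psi> \<in> test_functions B"
  from weak_product_rule_smooth[OF B f has_weak_gradient_const[OF B, of 1] this, of i]
  show "(LINT x|lebesgue_on B. f x * partial_deriv i \<psi> x) = - (LINT x|lebesgue_on B. grad f x $ i * \<psi> x)"
    by simp
qed

lemma norm_grad_bound:
  fixes f :: "real^'n::finite \<Rightarrow> real" and L :: real
  assumes "\<And>i. \<bar>partial_deriv i f x\<bar> \<le> L"
  shows "norm (grad f x) \<le> CARD('n) * L"
proof -
  have "norm (grad f x) \<le> (\<Sum>i\<in>UNIV. \<bar>grad f x $ i\<bar>)" by (rule norm_le_l1_cart)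
  also have "\<dots> \<le> (\<Sum>i\<in>(UNIV::'n set). L)" using assms by (intro sum_mono) simp
  finally show ?thesis by simp
qed

section \<open>Smooth approximants with almost everywhere convergent gradients\<close>

lemma partial_deriv_cmult:
  "f differentiable (at x) \<Longrightarrow> partial_deriv i (\<lambda>x. c * f x) x = c * partial_deriv i f x"
  by (subst partial_deriv_mult) auto

lemma smooth_cmult: "smooth f \<Longrightarrow> smooth (\<lambda>x. c * f x)"
  by (intro smooth_mult smooth_const)

lemma grad_midpoint:
  assumes "smooth f" "smooth g"
  shows "grad (\<lambda>x. 1/2 * (f x + g x)) x = (1/2) *\<^sub>R (grad f x + grad g x)"
  unfolding vec_eq_iff grad_nth vector_scaleR_component vector_add_component real_scaleR_def
    partial_deriv_cmult[OF smooth_differentiable[OF smooth_add[OF assms]]]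
    partial_deriv_add[OF assms[THEN smooth_differentiable]] by (intro allI refl)

text \<open>The conclusion is tailored to dominated convergence: the values converge uniformly, the
  gradients almost everywhere, and the partial derivatives have a bound independent of n. That P is
  the weak gradient of f is derived from these properties later.\<close>

lemma lipschitz_gradient_approx:
  fixes f :: "real^'n::finite \<Rightarrow> real"
  assumes B: "open B" "bounded B" and lip: "\<And>x y. \<bar>f x - f y\<bar> \<le> L * dist x y"
  shows "\<exists>F P. (\<forall>n. smooth (F n)) \<and> (\<forall>n x. \<bar>F n x - f x\<bar> \<le> 1 / Suc n) \<and>
    (\<forall>n i x. \<bar>partial_deriv i (F n) x\<bar> \<le> L) \<and> P \<in> borel_measurable (lebesgue_on B) \<and>
    (AE x in lebesgue_on B. (\<lambda>n. grad (F n) x) \<longlonglongrightarrow> P x)"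
proof -
  let ?M = "lebesgue_on B"
  interpret finite_measure ?M
    using B by (intro finite_measure_lebesgue_on lmeasurable_open)
  define S where "S n = {g. smooth g \<and> (\<forall>x. \<bar>g x - f x\<bar> \<le> 1 / real (Suc n)) \<and> (\<forall>i x. \<bar>partial_deriv i g x\<bar> \<le> L)}" for n :: nat
  define J where "J g = (LINT x|?M. (norm (grad g x))\<^sup>2)" for g :: "real^'n \<Rightarrow> real"
  define C where "C = CARD('n) * L"
  have S_ne: "S n \<noteq> {}" for n
    using lipschitz_smooth_approx[OF lip, of "1 / real (Suc n)"] by (auto simp: S_def)
  have S_mono: "S m \<subseteq> S n" if "n \<le> m" for m n
  proof -
    have "1 / real (Suc m) \<le> 1 / real (Suc n)" using that by (simp add: frac_le)
    then show ?thesis unfolding S_def by (auto intro: order_trans)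
  qed
  have mid: "\<bar>1/2 * (s + t) - c\<bar> \<le> e" if "\<bar>s - c\<bar> \<le> e" "\<bar>t - c\<bar> \<le> e" for s t c e :: real
    using that by (auto simp: abs_le_iff field_simps)
  have S_mid: "(\<lambda>x. 1/2 * (g x + h x)) \<in> S n" if g: "g \<in> S n" and h: "h \<in> S n" for g h n
  proof -
    have s: "smooth g" "smooth h" using g h by (auto simp: S_def)
    have 1: "\<bar>1/2 * (g x + h x) - f x\<bar> \<le> 1 / real (Suc n)" for x
    proof -
      have "\<bar>g x - f x\<bar> \<le> 1 / real (Suc n)" "\<bar>h x - f x\<bar> \<le> 1 / real (Suc n)"
        using g h by (auto simp: S_def)
      then show ?thesis by (rule mid)
    qed
    have 2: "\<bar>partial_deriv i (\<lambda>x. 1/2 * (g x + h x)) x\<bar> \<le> L" for i x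
    proof -
      have "partial_deriv i (\<lambda>x. 1/2 * (g x + h x)) x = 1/2 * (partial_deriv i g x + partial_deriv i h x)"
        using arg_cong[where f="\<lambda>v. v $ i", OF grad_midpoint[OF s, of x]] by simp
      moreover have "\<bar>partial_deriv i g x\<bar> \<le> L" "\<bar>partial_deriv i h x\<bar> \<le> L" using g h by (auto simp: S_def)
      ultimately show ?thesis using mid[of "partial_deriv i g x" 0 L "partial_deriv i h x"] by simp
    qed
    show ?thesis unfolding S_def using 1 2 smooth_cmult[OF smooth_add[OF s], of "1/2"] by blast
  qed
  have bound: "norm (grad g x) \<le> C" if "g \<in> S n" for g n x
    using that unfolding C_def by (intro norm_grad_bound) (auto simp: S_def)
  have sq: "(norm (grad g x))\<^sup>2 \<le> C\<^sup>2" if "g \<in> S n" for g n x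
    using bound[OF that] by (intro power_mono) auto
  have meas: "grad g \<in> borel_measurable ?M" if "g \<in> S n" for g n
    using that by (intro grad_measurable) (simp add: S_def)
  have bdd_int: "integrable ?M (\<lambda>x. (norm (h x))\<^sup>2)" if "h \<in> borel_measurable ?M" "\<And>x. norm (h x) \<le> c" for h :: "real^'n \<Rightarrow> real^'n" and c
  proof (rule integrable_const_bound[where B="c\<^sup>2"])
    show "AE x in ?M. norm ((norm (h x))\<^sup>2) \<le> c\<^sup>2"
      using that(2) by (intro AE_I2) (auto intro: power_mono)
    show "(\<lambda>x. (norm (h x))\<^sup>2) \<in> borel_measurable ?M" using that(1) by measurable
  qed
  note J_int = bdd_int[OF meas bound]
  have J_nonneg: "J g \<ge> 0" for g unfolding J_def by simp
  have J_le: "J g \<le> C\<^sup>2 * measure ?M (space ?M)" if "g \<in> S n" for g n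
  proof -
    have "J g \<le> (LINT x|?M. C\<^sup>2)" unfolding J_def using sq[OF that]
      by (intro integral_mono J_int[OF that that]) auto
    then show ?thesis by (simp add: mult.commute)
  qed
  \<comment> \<open>As the sets shrink the infima increase, and they are bounded by
    \<open>J_le\<close>. So they converge to some A, and the smallness of \<open>A - a n\<close> is
    what makes almost minimisers Cauchy.\<close>
  define a where "a n = Inf (J ` S n)" for n
  have bdd: "bdd_below (J ` X)" for X using J_nonneg by (intro bdd_belowI2[where m=0])
  have a_le: "a n \<le> J g" if "g \<in> S n" for g n
    unfolding a_def using that by (intro cInf_lower bdd) auto
  have a_mono: "a n \<le> a m" if "n \<le> m" for n m
    unfolding a_def by (intro cInf_superset_mono bdd image_mono S_mono that) (use S_ne in auto)
  have a_bdd: "a n \<le> C\<^sup>2 * measure ?M (space ?M)" for n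
  proof -
    obtain g where "g \<in> S n" using S_ne by blast
    from order_trans[OF a_le[OF this] J_le[OF this]] show ?thesis .
  qed
  obtain A where A: "a \<longlonglongrightarrow> A" "\<And>n. a n \<le> A"
    using incseq_convergent[of a, OF _ allI[OF a_bdd]] a_mono by (auto simp: incseq_def)
  have "\<exists>g\<in>S n. J g < a n + 1 / real (Suc n)" for n
  proof -
    have "\<exists>y\<in>J ` S n. y < a n + 1 / real (Suc n)"
      using cInf_lessD[of "J ` S n" "a n + 1 / real (Suc n)"] S_ne by (auto simp: a_def)
    then show ?thesis by blast
  qed
  then obtain G where G: "\<And>n. G n \<in> S n" "\<And>n. J (G n) < a n + 1 / real (Suc n)" by metis
  have G_meas: "grad (G n) \<in> borel_measurable ?M" for n using meas[OF G(1)] .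
  have diff_bound: "norm (grad (G n) x - grad (G m) x) \<le> 2 * C" for n m x
    using norm_triangle_ineq4[of "grad (G n) x" "grad (G m) x"] bound[OF G(1), of n x] bound[OF G(1), of m x] by linarith
  have diff_int: "integrable ?M (\<lambda>x. (norm (grad (G n) x - grad (G m) x))\<^sup>2)" for n m
    by (rule bdd_int[OF _ diff_bound]) (intro borel_measurable_diff G_meas)
  \<comment> \<open>For n \<le> m both functions and their midpoint lie in \<open>S n\<close>, so
    the midpoint has energy at least \<open>a n\<close>. The parallelogram law then leaves at most
    \<open>2 * (a m - a n)\<close> plus twice the errors of the two almost minimisers.\<close>
  have par: "(LINT x|?M. (norm (grad (G n) x - grad (G m) x))\<^sup>2) \<le> 2 * (A - a n) + 4 / real (Suc n)" if "n \<le> m" for n m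
  proof -
    define h where "h = (\<lambda>x. 1/2 * (G n x + G m x))"
    have Gm: "G m \<in> S n" using S_mono[OF that] G(1) by blast
    have h: "h \<in> S n" unfolding h_def by (rule S_mid[OF G(1) Gm])
    have s: "smooth (G n)" "smooth (G m)" using G(1) by (auto simp: S_def)
    have gh: "grad h x = (1/2) *\<^sub>R (grad (G n) x + grad (G m) x)" for x
      unfolding h_def by (rule grad_midpoint[OF s])
    have "(norm (v - w))\<^sup>2 = 2 * (norm v)\<^sup>2 + 2 * (norm w)\<^sup>2 - 4 * (norm ((1/2) *\<^sub>R (v + w)))\<^sup>2" for v w :: "real^'n"
      by (simp add: power2_norm_eq_inner inner_diff inner_add inner_commute algebra_simps)
    then have "(norm (grad (G n) x - grad (G m) x))\<^sup>2 =
       2 * (norm (grad (G n) x))\<^sup>2 + 2 * (norm (grad (G m) x))\<^sup>2 - 4 * (norm (grad h x))\<^sup>2" for x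
      unfolding gh .
    then have "(LINT x|?M. (norm (grad (G n) x - grad (G m) x))\<^sup>2) = 2 * J (G n) + 2 * J (G m) - 4 * J h"
      using J_int[OF G(1) G(1), of n] J_int[OF G(1) G(1), of m] J_int[OF h h]
      by (simp add: J_def)
    also have "\<dots> \<le> 2 * (a n + 1 / real (Suc n)) + 2 * (a m + 1 / real (Suc m)) - 4 * a n"
    proof -
      have "2 * p + 2 * q - 4 * t \<le> 2 * (k + s) + 2 * (l + r) - 4 * k"
        if "p < k + s" "q < l + r" "k \<le> t" for p q s t k l r :: real
        using that by argo
      from this[OF G(2)[of n] G(2)[of m] a_le[OF h]] show ?thesis .
    qed
    also have "\<dots> \<le> 2 * (A - a n) + 4 / real (Suc n)"
    proof -
      have "1 / real (Suc m) \<le> 1 / real (Suc n)" using that by (simp add: frac_le)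
      then show ?thesis using A(2)[of m] by simp
    qed
    finally show ?thesis .
  qed
  \<comment> \<open>\<open>cauchy_L1_AE_cauchy_subseq\<close> asks for the Cauchy property in L1, so
    the L2 estimate is converted, using that B has finite measure.\<close>
  have cauchy: "\<exists>N. \<forall>i\<ge>N. \<forall>j\<ge>N. (LINT x|?M. norm (grad (G i) x - grad (G j) x)) < e" if e: "e > 0" for e
  proof -
    define \<mu> where "\<mu> = measure ?M (space ?M)"
    have \<mu>: "\<mu> \<ge> 0" by (simp add: \<mu>_def)
    \<comment> \<open>Chosen so that the constant part of the pointwise bound below contributes at
      most e / 2; \<mu> + 1 avoids division by 0 when B is empty.\<close>
    define \<delta> where "\<delta> = e / (2 * (\<mu> + 1))"
    have \<delta>: "\<delta> > 0" "\<delta> * \<mu> \<le> e / 2" using e \<mu> by (auto simp: \<delta>_def field_simps)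
    have "(\<lambda>n. 2 * (A - a n) + 4 * (1 / real (Suc n))) \<longlonglongrightarrow> 2 * (A - A) + 4 * 0"
      using LIMSEQ_inverse_real_of_nat A(1) by (intro tendsto_intros) (auto simp: inverse_eq_divide)
    then have "eventually (\<lambda>n. 2 * (A - a n) + 4 / real (Suc n) < \<delta> * (e / 2)) sequentially"
      using \<delta>(1) e by (intro order_tendstoD(2)[where y="0::real"]) auto
    then obtain N where N: "\<And>n. n \<ge> N \<Longrightarrow> 2 * (A - a n) + 4 / real (Suc n) < \<delta> * (e / 2)"
      by (auto simp: eventually_sequentially)
    have le: "(LINT x|?M. norm (grad (G i) x - grad (G j) x)) < e" if "i \<ge> N" "i \<le> j" for i j
    proof -
      let ?v = "\<lambda>x. grad (G i) x - grad (G j) x"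
      have vm: "?v \<in> borel_measurable ?M" by (intro borel_measurable_diff G_meas)
      \<comment> \<open>Where |v| exceeds \<delta>, it is at most |v|^2 / \<delta>; this turns
        smallness in L2 into smallness in L1.\<close>
      have *: "norm v \<le> \<delta> + (norm v)\<^sup>2 / \<delta>" for v :: "real^'n"
      proof (cases "norm v \<le> \<delta>")
        case True then show ?thesis using \<delta>(1) by (intro add_increasing2) auto
      next
        case False
        then have "\<delta> * norm v \<le> norm v * norm v" by (intro mult_right_mono) auto
        then have "norm v \<le> (norm v)\<^sup>2 / \<delta>" using \<delta>(1) by (simp add: field_simps power2_eq_square)
        then show ?thesis using \<delta>(1) by linarith
      qed
      have "(LINT x|?M. norm (?v x)) \<le> (LINT x|?M. \<delta> + (norm (?v x))\<^sup>2 / \<delta>)"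
      proof (rule integral_mono)
        show "integrable ?M (\<lambda>x. norm (?v x))"
          using diff_bound[of i _ j] vm by (intro integrable_norm integrable_const_bound[where B="2 * C"]) auto
        show "integrable ?M (\<lambda>x. \<delta> + (norm (?v x))\<^sup>2 / \<delta>)"
          by (intro Bochner_Integration.integrable_add integrable_divide diff_int) simp
      qed (rule *)
      also have "\<dots> = \<delta> * \<mu> + (LINT x|?M. (norm (?v x))\<^sup>2) / \<delta>"
        using diff_int[of i j] by (simp add: \<mu>_def mult.commute)
      also have "\<dots> < e / 2 + e / 2"
      proof (rule add_le_less_mono[OF \<delta>(2)])
        have "(LINT x|?M. (norm (?v x))\<^sup>2) < \<delta> * (e / 2)"
          using par[OF that(2)] N[OF that(1)] by (rule order.strict_trans1)
        then show "(LINT x|?M. (norm (?v x))\<^sup>2) / \<delta> < e / 2" using \<delta>(1) by (simp add: field_simps)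
      qed
      finally show ?thesis by simp
    qed
    have "(LINT x|?M. norm (grad (G i) x - grad (G j) x)) < e" if "i \<ge> N" "j \<ge> N" for i j
      using le[of i j] le[of j i] that by (cases "i \<le> j") (auto simp: norm_minus_commute)
    then show ?thesis by blast
  qed
  have G_int: "integrable ?M (grad (G n))" for n
    using bound[OF G(1)] by (intro integrable_const_bound[where B=C] G_meas) auto
  obtain r where r: "strict_mono r" "AE x in ?M. Cauchy (\<lambda>i. grad (G (r i)) x)"
    using cauchy_L1_AE_cauchy_subseq[of ?M "\<lambda>n. grad (G n)", OF G_int cauchy] by blast
  show ?thesis
  proof (intro exI conjI allI)
    fix n i x
    \<comment> \<open>Since \<open>r n \<ge> n\<close> and the sets decrease, the subsequence keeps
      the accuracy 1 / (n + 1).\<close>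
    have m: "G (r n) \<in> S n" using S_mono[OF seq_suble[OF r(1), of n]] G(1) by blast
    then show "smooth (G (r n))" "\<bar>G (r n) x - f x\<bar> \<le> 1 / Suc n" "\<bar>partial_deriv i (G (r n)) x\<bar> \<le> L"
      by (auto simp: S_def)
  next
    show "(\<lambda>x. lim (\<lambda>n. grad (G (r n)) x)) \<in> borel_measurable ?M"
      by (intro borel_measurable_lim_metric G_meas)
    show "AE x in ?M. (\<lambda>n. grad (G (r n)) x) \<longlonglongrightarrow> lim (\<lambda>n. grad (G (r n)) x)"
      using r(2) by eventually_elim (auto simp: Cauchy_convergent_iff convergent_LIMSEQ_iff)
  qed
qed

section \<open>Square-integrable and essentially bounded functions\<close>

lemma L2_iff_real:
  "f \<in> L2 B \<longleftrightarrow> f \<in> borel_measurable (lebesgue_on B) \<and> integrable (lebesgue_on B) (\<lambda>x. (f x)\<^sup>2)"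
  for f :: "real^'n::finite \<Rightarrow> real"
  by (simp add: L2_def)

lemma L2_mult_integrable:
  fixes f g :: "real^'n::finite \<Rightarrow> real"
  assumes "f \<in> L2 B" "g \<in> L2 B"
  shows "integrable (lebesgue_on B) (\<lambda>x. f x * g x)"
proof (rule Bochner_Integration.integrable_bound)
  show "integrable (lebesgue_on B) (\<lambda>x. (f x)\<^sup>2 + (g x)\<^sup>2)"
    using assms by (simp add: L2_iff_real)
  show "(\<lambda>x. f x * g x) \<in> borel_measurable (lebesgue_on B)"
    using assms by (auto simp: L2_iff_real)
  have "\<bar>a * b\<bar> \<le> a\<^sup>2 + b\<^sup>2" for a b :: real
  proof -
    have "2 * (\<bar>a\<bar> * \<bar>b\<bar>) \<le> \<bar>a\<bar>\<^sup>2 + \<bar>b\<bar>\<^sup>2" using sum_squares_bound[of "\<bar>a\<bar>" "\<bar>b\<bar>"] by simp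
    moreover have "0 \<le> \<bar>a\<bar> * \<bar>b\<bar>" by simp
    ultimately have "\<bar>a\<bar> * \<bar>b\<bar> \<le> \<bar>a\<bar>\<^sup>2 + \<bar>b\<bar>\<^sup>2" by linarith
    then show ?thesis by (simp add: abs_mult)
  qed
  then show "AE x in lebesgue_on B. norm (f x * g x) \<le> norm ((f x)\<^sup>2 + (g x)\<^sup>2)" by simp
qed

lemma L2_diff:
  fixes f g :: "real^'n::finite \<Rightarrow> real"
  assumes "f \<in> L2 B" "g \<in> L2 B"
  shows "(\<lambda>x. f x - g x) \<in> L2 B"
  using assms L2_mult_integrable[OF assms]
  by (auto simp: L2_iff_real power2_diff mult.assoc)

lemma L2_add:
  fixes f g :: "real^'n::finite \<Rightarrow> real"
  assumes "f \<in> L2 B" "g \<in> L2 B"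
  shows "(\<lambda>x. f x + g x) \<in> L2 B"
  using assms L2_mult_integrable[OF assms]
  by (auto simp: L2_iff_real power2_sum mult.assoc)

lemma Linf_mult_integrable:
  fixes c f :: "real^'n::finite \<Rightarrow> real"
  assumes "c \<in> Linf B" "integrable (lebesgue_on B) f"
  shows "integrable (lebesgue_on B) (\<lambda>x. c x * f x)"
proof -
  obtain M where c: "c \<in> borel_measurable (lebesgue_on B)" "AE x in lebesgue_on B. \<bar>c x\<bar> \<le> M"
    using assms(1) by (auto simp: Linf_def)
  show ?thesis
  proof (rule Bochner_Integration.integrable_bound[OF integrable_mult_right[OF assms(2), of M]])
    show "(\<lambda>x. c x * f x) \<in> borel_measurable (lebesgue_on B)"
      by (intro borel_measurable_times c(1) borel_measurable_integrable assms(2))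
    show "AE x in lebesgue_on B. norm (c x * f x) \<le> norm (M * f x)"
      using c(2)
    proof eventually_elim
      case (elim x)
      then show ?case by (auto simp: abs_mult intro!: mult_right_mono)
    qed
  qed
qed

lemma Linf_L2_mult:
  fixes c f :: "real^'n::finite \<Rightarrow> real"
  assumes "c \<in> Linf B" "f \<in> L2 B"
  shows "(\<lambda>x. c x * f x) \<in> L2 B"
proof -
  have m: "c \<in> borel_measurable (lebesgue_on B)" using assms(1) by (simp add: Linf_def)
  have "integrable (lebesgue_on B) (\<lambda>x. c x * (c x * (f x)\<^sup>2))"
    using assms by (intro Linf_mult_integrable) (auto simp: L2_iff_real)
  then show ?thesis using assms(2) m by (auto simp: L2_iff_real power_mult_distrib power2_eq_square ac_simps)
qed

lemma Linf_const: "(\<lambda>x. c) \<in> Linf B"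
  by (auto simp: Linf_def intro!: exI[of _ "norm c"])

lemma Linf_mult:
  fixes f g :: "real^'n::finite \<Rightarrow> real"
  assumes "f \<in> Linf B" "g \<in> Linf B"
  shows "(\<lambda>x. f x * g x) \<in> Linf B"
proof -
  obtain M N where b: "AE x in lebesgue_on B. norm (f x) \<le> M" "AE x in lebesgue_on B. norm (g x) \<le> N"
    using assms by (auto simp: Linf_def)
  then have "AE x in lebesgue_on B. norm (f x * g x) \<le> M * N"
  proof eventually_elim
    case (elim x)
    have "0 \<le> M" using elim(1) norm_ge_zero order_trans by blast
    then have "norm (f x) * norm (g x) \<le> M * N" using elim by (intro mult_mono) auto
    then show ?case by (simp add: abs_mult)
  qed
  with assms show ?thesis by (auto simp: Linf_def)
qed

lemma Linf_add:
  fixes f g :: "real^'n::finite \<Rightarrow> real"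
  assumes "f \<in> Linf B" "g \<in> Linf B"
  shows "(\<lambda>x. f x + g x) \<in> Linf B"
proof -
  obtain M N where b: "AE x in lebesgue_on B. norm (f x) \<le> M" "AE x in lebesgue_on B. norm (g x) \<le> N"
    using assms by (auto simp: Linf_def)
  then have "AE x in lebesgue_on B. norm (f x + g x) \<le> M + N"
    by eventually_elim auto
  with assms show ?thesis by (auto simp: Linf_def)
qed

lemma Linf_diff:
  fixes f g :: "real^'n::finite \<Rightarrow> real"
  assumes "f \<in> Linf B" "g \<in> Linf B"
  shows "(\<lambda>x. f x - g x) \<in> Linf B"
  using Linf_add[OF assms(1) Linf_mult[OF Linf_const[of "-1"] assms(2)]] by simp

lemma Linf_sum:
  fixes f :: "'i \<Rightarrow> real^'n::finite \<Rightarrow> real"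
  assumes "\<And>i. i \<in> I \<Longrightarrow> f i \<in> Linf B"
  shows "(\<lambda>x. \<Sum>i\<in>I. f i x) \<in> Linf B"
  using assms by (induction I rule: infinite_finite_induct) (auto intro: Linf_const Linf_add)

lemma Linf_max_0:
  fixes f :: "real^'n::finite \<Rightarrow> real"
  assumes "f \<in> Linf B"
  shows "(\<lambda>x. max (f x) 0) \<in> Linf B"
proof -
  obtain M where "AE x in lebesgue_on B. norm (f x) \<le> M" using assms by (auto simp: Linf_def)
  then have "AE x in lebesgue_on B. norm (max (f x) 0) \<le> M"
    by eventually_elim auto
  with assms show ?thesis by (auto simp: Linf_def)
qed

lemma Linf_subset_L2:
  fixes f :: "real^'n::finite \<Rightarrow> real"
  assumes "open B" "bounded B" "f \<in> Linf B"
  shows "f \<in> L2 B"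
proof -
  interpret finite_measure "lebesgue_on B"
    using assms by (intro finite_measure_lebesgue_on lmeasurable_open)
  have "(\<lambda>x. 1 :: real) \<in> L2 B" by (simp add: L2_iff_real)
  from Linf_L2_mult[OF assms(3) this] show ?thesis by simp
qed

lemma test_functions_Linf:
  fixes \<psi> :: "real^'n::finite \<Rightarrow> real"
  assumes "\<psi> \<in> test_functions B"
  shows "\<psi> \<in> Linf B"
proof -
  obtain K where K: "compact K" "\<And>x. x \<notin> K \<Longrightarrow> \<psi> x = 0" using assms by (metis test_functionsE)
  have "bounded (\<psi> ` K)"
    by (intro compact_imp_bounded compact_continuous_image smooth_continuous test_functions_smooth[OF assms] K)
  then obtain M where M: "\<And>x. x \<in> K \<Longrightarrow> \<bar>\<psi> x\<bar> \<le> M"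
    unfolding bounded_iff by (metis imageI real_norm_def)
  have "norm (\<psi> x) \<le> \<bar>M\<bar>" for x using M[of x] K(2)[of x] by (cases "x \<in> K") auto
  then show ?thesis
    using smooth_measurable_lebesgue_on[OF test_functions_smooth[OF assms]] by (auto simp: Linf_def)
qed

text \<open>The integral of (s |f| - |g|)^2 is a nonnegative quadratic polynomial in s, so its
  discriminant is not positive.\<close>

lemma Cauchy_Schwarz_L2:
  fixes f g :: "real^'n::finite \<Rightarrow> real"
  assumes "f \<in> L2 B" "g \<in> L2 B"
  shows "(LINT x|lebesgue_on B. \<bar>f x * g x\<bar>) \<le>
    sqrt (LINT x|lebesgue_on B. (f x)\<^sup>2) * sqrt (LINT x|lebesgue_on B. (g x)\<^sup>2)"
proof -
  let ?M = "lebesgue_on B"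
  define A where "A = (LINT x|?M. (f x)\<^sup>2)"
  define C where "C = (LINT x|?M. (g x)\<^sup>2)"
  define I where "I = (LINT x|?M. \<bar>f x * g x\<bar>)"
  have pos: "A \<ge> 0" "C \<ge> 0" "I \<ge> 0" by (auto simp: A_def C_def I_def)
  have int: "integrable ?M (\<lambda>x. (f x)\<^sup>2)" "integrable ?M (\<lambda>x. (g x)\<^sup>2)" "integrable ?M (\<lambda>x. \<bar>f x * g x\<bar>)"
    using assms L2_mult_integrable[OF assms] by (auto simp: L2_iff_real)
  have q: "0 \<le> s\<^sup>2 * A - 2 * s * I + C" for s :: real
  proof -
    have "0 \<le> (LINT x|?M. (s * \<bar>f x\<bar> - \<bar>g x\<bar>)\<^sup>2)" by simp
    also have "(\<lambda>x. (s * \<bar>f x\<bar> - \<bar>g x\<bar>)\<^sup>2) = (\<lambda>x. s\<^sup>2 * (f x)\<^sup>2 - 2 * s * \<bar>f x * g x\<bar> + (g x)\<^sup>2)"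
      by (simp add: power2_diff power_mult_distrib abs_mult algebra_simps)
    also have "(LINT x|?M. s\<^sup>2 * (f x)\<^sup>2 - 2 * s * \<bar>f x * g x\<bar> + (g x)\<^sup>2) = s\<^sup>2 * A - 2 * s * I + C"
      using int by (simp add: A_def C_def I_def)
    finally show ?thesis .
  qed
  have "I\<^sup>2 \<le> A * C"
  proof (cases "A = 0")
    case True
    have "I \<le> 0"
    proof (rule ccontr)
      assume "\<not> I \<le> 0"
      \<comment> \<open>With A = 0 the quadratic is the affine function C - 2 s I; at this s it
        equals - C - 2 < 0.\<close>
      then show False using q[of "(C + 1) / I"] True pos(2) by simp
    qed
    then show ?thesis using pos True by simp
  next
    case False
    \<comment> \<open>The minimiser of the quadratic.\<close>
    with q[of "I / A"] pos show ?thesis by (simp add: power2_eq_square field_simps)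
  qed
  then have "sqrt (I\<^sup>2) \<le> sqrt (A * C)" by (rule real_sqrt_le_mono)
  then show ?thesis using pos by (simp add: real_sqrt_mult A_def C_def I_def)
qed

text \<open>With p and q the errors of the two factors, the difference of the products is f q + p g
  + p q, and Cauchy-Schwarz bounds each term. The bounded weight c stands apart so that all
  coefficients can be carried through the limit.\<close>

lemma L2_limit_mult:
  fixes f g c :: "real^'n::finite \<Rightarrow> real"
  assumes c: "c \<in> Linf B" and f: "f \<in> L2 B" "\<And>k. fs k \<in> L2 B" and g: "g \<in> L2 B" "\<And>k. gs k \<in> L2 B"
    and fl: "(\<lambda>k. LINT x|lebesgue_on B. (fs k x - f x)\<^sup>2) \<longlonglongrightarrow> 0"
    and gl: "(\<lambda>k. LINT x|lebesgue_on B. (gs k x - g x)\<^sup>2) \<longlonglongrightarrow> 0"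
  shows "(\<lambda>k. LINT x|lebesgue_on B. c x * (fs k x * gs k x)) \<longlonglongrightarrow> (LINT x|lebesgue_on B. c x * (f x * g x))"
proof -
  let ?M = "lebesgue_on B"
  define S where "S h = sqrt (LINT x|?M. (h x)\<^sup>2)" for h :: "real^'n \<Rightarrow> real"
  obtain M where M: "AE x in ?M. \<bar>c x\<bar> \<le> M" using c by (auto simp: Linf_def)
  have est: "\<bar>LINT x|?M. c x * (p x * q x)\<bar> \<le> \<bar>M\<bar> * (S p * S q)" if "p \<in> L2 B" "q \<in> L2 B" for p q
  proof -
    have i: "integrable ?M (\<lambda>x. p x * q x)" using that by (rule L2_mult_integrable)
    have "\<bar>LINT x|?M. c x * (p x * q x)\<bar> \<le> (LINT x|?M. \<bar>c x * (p x * q x)\<bar>)" by simp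
    also have "\<dots> \<le> (LINT x|?M. \<bar>M\<bar> * \<bar>p x * q x\<bar>)"
    proof (rule integral_mono_AE)
      show "integrable ?M (\<lambda>x. \<bar>c x * (p x * q x)\<bar>)"
        by (intro integrable_abs Linf_mult_integrable c i)
      show "integrable ?M (\<lambda>x. \<bar>M\<bar> * \<bar>p x * q x\<bar>)" using i by simp
      show "AE x in ?M. \<bar>c x * (p x * q x)\<bar> \<le> \<bar>M\<bar> * \<bar>p x * q x\<bar>"
        using M
      proof eventually_elim
        case (elim x)
        then show ?case unfolding abs_mult[of "c x"] by (intro mult_right_mono) auto
      qed
    qed
    also have "\<dots> = \<bar>M\<bar> * (LINT x|?M. \<bar>p x * q x\<bar>)" using i by simp
    also have "\<dots> \<le> \<bar>M\<bar> * (S p * S q)"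
      unfolding S_def by (intro mult_left_mono Cauchy_Schwarz_L2 that) simp
    finally show ?thesis .
  qed
  define p where "p k x = fs k x - f x" for k x
  define q where "q k x = gs k x - g x" for k x
  have pq: "p k \<in> L2 B" "q k \<in> L2 B" for k
    unfolding p_def q_def by (intro L2_diff f g)+
  have Sp: "(\<lambda>k. S (p k)) \<longlonglongrightarrow> 0" and Sq: "(\<lambda>k. S (q k)) \<longlonglongrightarrow> 0"
    using tendsto_real_sqrt[OF fl] tendsto_real_sqrt[OF gl] by (simp_all add: S_def p_def q_def)
  have eq: "(LINT x|?M. c x * (fs k x * gs k x)) - (LINT x|?M. c x * (f x * g x)) =
      (LINT x|?M. c x * (f x * q k x)) + (LINT x|?M. c x * (p k x * g x)) + (LINT x|?M. c x * (p k x * q k x))" for k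
  proof -
    note i = Linf_mult_integrable[OF c L2_mult_integrable]
    have "(\<lambda>x. c x * (fs k x * gs k x)) =
        (\<lambda>x. c x * (f x * g x) + c x * (f x * q k x) + c x * (p k x * g x) + c x * (p k x * q k x))"
      by (rule ext) (simp add: p_def q_def algebra_simps)
    then show ?thesis
      using i[OF f(1) g(1)] i[OF f(1) pq(2)] i[OF pq(1) g(1)] i[OF pq] by simp
  qed
  have "(\<lambda>k. (LINT x|?M. c x * (fs k x * gs k x)) - (LINT x|?M. c x * (f x * g x))) \<longlonglongrightarrow> 0"
  proof (rule Lim_null_comparison)
    show "eventually (\<lambda>k. norm ((LINT x|?M. c x * (fs k x * gs k x)) - (LINT x|?M. c x * (f x * g x))) \<le>
        \<bar>M\<bar> * (S f * S (q k)) + \<bar>M\<bar> * (S (p k) * S g) + \<bar>M\<bar> * (S (p k) * S (q k))) sequentially"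
      unfolding eq real_norm_def
      by (intro always_eventually allI order_trans[OF abs_triangle_ineq] add_mono est f g pq)
    have "(\<lambda>k. \<bar>M\<bar> * (S f * S (q k)) + \<bar>M\<bar> * (S (p k) * S g) + \<bar>M\<bar> * (S (p k) * S (q k))) \<longlonglongrightarrow>
        \<bar>M\<bar> * (S f * 0) + \<bar>M\<bar> * (0 * S g) + \<bar>M\<bar> * (0 * 0)"
      by (intro tendsto_intros Sp Sq)
    then show "(\<lambda>k. \<bar>M\<bar> * (S f * S (q k)) + \<bar>M\<bar> * (S (p k) * S g) + \<bar>M\<bar> * (S (p k) * S (q k))) \<longlonglongrightarrow> 0"
      by simp
  qed
  then show ?thesis by (simp add: LIM_zero_iff)
qed

section \<open>Functions with bounded weak gradient\<close>

text \<open>M and L bound values and partial derivatives uniformly in n and supply the dominating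
  functions in the limits over n. P enters only as a measurable almost everywhere limit of classical
  gradients; that it is the weak gradient of \<phi> is a consequence.\<close>

locale gradient_approximation =
  fixes B :: "(real^'n::finite) set" and F :: "nat \<Rightarrow> real^'n \<Rightarrow> real"
    and \<phi> :: "real^'n \<Rightarrow> real" and P :: "real^'n \<Rightarrow> real^'n" and M L :: real
  assumes open_B: "open B" and bounded_B: "bounded B"
    and smooth_F: "smooth (F n)"
    and F_bound: "\<bar>F n x\<bar> \<le> M"
    and partial_deriv_F_bound: "\<bar>partial_deriv i (F n) x\<bar> \<le> L"
    and F_tendsto: "(\<lambda>n. F n x) \<longlonglongrightarrow> \<phi> x"
    and P_measurable: "P \<in> borel_measurable (lebesgue_on B)"
    and grad_F_tendsto: "AE x in lebesgue_on B. (\<lambda>n. grad (F n) x) \<longlonglongrightarrow> P x"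
begin

lemma phi_measurable: "\<phi> \<in> borel_measurable (lebesgue_on B)"
  by (rule borel_measurable_LIMSEQ_metric[OF smooth_measurable_lebesgue_on[OF smooth_F]]) (rule F_tendsto)

lemma phi_bound: "\<bar>\<phi> x\<bar> \<le> M"
  by (rule tendsto_upperbound[OF tendsto_rabs[OF F_tendsto]]) (simp_all add: F_bound)

lemma phi_Linf: "\<phi> \<in> Linf B"
  using phi_measurable phi_bound by (auto simp: Linf_def)

lemma partial_tendsto: "AE x in lebesgue_on B. (\<lambda>n. partial_deriv i (F n) x) \<longlonglongrightarrow> P x $ i"
  using grad_F_tendsto
proof eventually_elim
  case (elim x)
  from tendsto_vec_nth[OF this, of i] show ?case by simp
qed

lemma P_bound: "AE x in lebesgue_on B. \<bar>P x $ i\<bar> \<le> L"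
  using partial_tendsto[of i]
proof eventually_elim
  case (elim x)
  show ?case by (rule tendsto_upperbound[OF tendsto_rabs[OF elim]]) (simp_all add: partial_deriv_F_bound)
qed

lemma P_nth_measurable: "(\<lambda>x. P x $ i) \<in> borel_measurable (lebesgue_on B)"
  using measurable_compose[OF P_measurable borel_measurable_continuous_onI[OF
      linear_continuous_on[OF bounded_linear_vec_nth[of i]]]] .

lemma P_Linf: "(\<lambda>x. P x $ i) \<in> Linf B"
  using P_nth_measurable P_bound by (auto simp: Linf_def)

lemma norm_P_bound: "AE x in lebesgue_on B. norm (P x) \<le> CARD('n) * L"
proof -
  have "AE x in lebesgue_on B. \<forall>i\<in>UNIV. \<bar>P x $ i\<bar> \<le> L"
    by (intro AE_finite_allI P_bound) simp
  then show ?thesis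
  proof eventually_elim
    case (elim x)
    have "norm (P x) \<le> (\<Sum>i\<in>UNIV. \<bar>P x $ i\<bar>)" by (rule norm_le_l1_cart)
    also have "\<dots> \<le> (\<Sum>i\<in>(UNIV::'n set). L)" using elim by (intro sum_mono) simp
    finally show ?case by simp
  qed
qed

text \<open>The limit of \<open>weak_product_rule_smooth\<close> with f = \<open>F n\<close>: on the
  support of a test function u and G are integrable, and M and L dominate the other factors.\<close>

lemma has_weak_gradient_mult:
  assumes u: "has_weak_gradient B u G"
  shows "has_weak_gradient B (\<lambda>x. \<phi> x * u x) (\<lambda>x. \<phi> x *\<^sub>R G x + u x *\<^sub>R P x)"
  unfolding has_weak_gradient_iff
proof (intro conjI ballI allI)
  let ?M = "lebesgue_on B"
  have l: "locally_integrable_on B u" "locally_integrable_on B G"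
    and li: "locally_integrable_on B (\<lambda>x. G x $ i)" for i
    using u by (auto simp: has_weak_gradient_iff intro: locally_integrable_on_nth)
  note m = locally_integrable_on_measurable[OF open_B l(1)] locally_integrable_on_measurable[OF open_B l(2)]
    locally_integrable_on_measurable[OF open_B li]
  show "locally_integrable_on B (\<lambda>x. \<phi> x * u x)"
  proof (rule locally_integrable_on_bound[OF open_B l(1)])
    show "AE x in ?M. norm (\<phi> x * u x) \<le> M * norm (u x)"
      by (intro AE_I2) (simp add: abs_mult mult_right_mono phi_bound)
  qed (intro borel_measurable_times phi_measurable m)
  show "locally_integrable_on B (\<lambda>x. \<phi> x *\<^sub>R G x + u x *\<^sub>R P x)"
  proof (rule locally_integrable_on_add)
    show "locally_integrable_on B (\<lambda>x. \<phi> x *\<^sub>R G x)"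
    proof (rule locally_integrable_on_bound[OF open_B l(2)])
      show "AE x in ?M. norm (\<phi> x *\<^sub>R G x) \<le> M * norm (G x)"
        by (intro AE_I2) (simp add: mult_right_mono phi_bound)
    qed (intro borel_measurable_scaleR phi_measurable m)
    show "locally_integrable_on B (\<lambda>x. u x *\<^sub>R P x)"
    proof (rule locally_integrable_on_bound[OF open_B l(1)])
      show "AE x in ?M. norm (u x *\<^sub>R P x) \<le> (CARD('n) * L) * norm (u x)"
        using norm_P_bound
      proof eventually_elim
        case (elim x)
        from mult_left_mono[OF elim, of "\<bar>u x\<bar>"] show ?case by (simp add: mult.commute)
      qed
    qed (intro borel_measurable_scaleR P_measurable m)
  qed
  fix \<psi> i assume \<psi>: "\<psi> \<in> test_functions B"
  note p = partial_deriv_test_functions[OF \<psi>, of i]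
  have \<psi>_m: "\<psi> \<in> borel_measurable ?M" "partial_deriv i \<psi> \<in> borel_measurable ?M"
    by (intro smooth_measurable_lebesgue_on test_functions_smooth[OF \<psi>] test_functions_smooth[OF p])+
  have F_m: "F n \<in> borel_measurable ?M" "partial_deriv i (F n) \<in> borel_measurable ?M" for n
    by (intro smooth_measurable_lebesgue_on smooth_partial_deriv smooth_F)+
  have lim1: "(\<lambda>n. LINT x|?M. F n x * u x * partial_deriv i \<psi> x) \<longlonglongrightarrow> (LINT x|?M. \<phi> x * u x * partial_deriv i \<psi> x)"
  proof (rule integral_dominated_convergence[where w="\<lambda>x. M * \<bar>u x * partial_deriv i \<psi> x\<bar>"])
    show "(\<lambda>x. \<phi> x * u x * partial_deriv i \<psi> x) \<in> borel_measurable ?M"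
      by (intro borel_measurable_times phi_measurable m \<psi>_m)
    show "(\<lambda>x. F n x * u x * partial_deriv i \<psi> x) \<in> borel_measurable ?M" for n
      by (intro borel_measurable_times F_m m \<psi>_m)
    show "integrable ?M (\<lambda>x. M * \<bar>u x * partial_deriv i \<psi> x\<bar>)"
      by (intro integrable_mult_right integrable_abs test_mult_integrable[OF open_B l(1) p])
    show "AE x in ?M. (\<lambda>n. F n x * u x * partial_deriv i \<psi> x) \<longlonglongrightarrow> \<phi> x * u x * partial_deriv i \<psi> x"
      by (intro AE_I2 tendsto_intros F_tendsto)
    show "AE x in ?M. norm (F n x * u x * partial_deriv i \<psi> x) \<le> M * \<bar>u x * partial_deriv i \<psi> x\<bar>" for n
      unfolding mult.assoc real_norm_def abs_mult[of "F n _"] by (intro AE_I2 mult_right_mono F_bound) simp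
  qed
  have lim2: "(\<lambda>n. LINT x|?M. (F n x * G x $ i + u x * partial_deriv i (F n) x) * \<psi> x) \<longlonglongrightarrow>
      (LINT x|?M. (\<phi> x *\<^sub>R G x + u x *\<^sub>R P x) $ i * \<psi> x)"
  proof (rule integral_dominated_convergence[where w="\<lambda>x. M * \<bar>G x $ i * \<psi> x\<bar> + L * \<bar>u x * \<psi> x\<bar>"])
    have "(\<lambda>x. (\<phi> x * G x $ i + u x * P x $ i) * \<psi> x) \<in> borel_measurable ?M"
      by (intro borel_measurable_times borel_measurable_add phi_measurable m \<psi>_m P_nth_measurable)
    then show "(\<lambda>x. (\<phi> x *\<^sub>R G x + u x *\<^sub>R P x) $ i * \<psi> x) \<in> borel_measurable ?M" by simp
    show "(\<lambda>x. (F n x * G x $ i + u x * partial_deriv i (F n) x) * \<psi> x) \<in> borel_measurable ?M" for n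
      by (intro borel_measurable_times borel_measurable_add F_m m \<psi>_m)
    show "integrable ?M (\<lambda>x. M * \<bar>G x $ i * \<psi> x\<bar> + L * \<bar>u x * \<psi> x\<bar>)"
      by (intro Bochner_Integration.integrable_add integrable_mult_right integrable_abs
          test_mult_integrable[OF open_B l(1) \<psi>] test_mult_integrable[OF open_B li \<psi>])
    show "AE x in ?M. (\<lambda>n. (F n x * G x $ i + u x * partial_deriv i (F n) x) * \<psi> x) \<longlonglongrightarrow>
        (\<phi> x *\<^sub>R G x + u x *\<^sub>R P x) $ i * \<psi> x"
      using partial_tendsto[of i]
    proof eventually_elim
      case (elim x)
      have "(\<lambda>n. (F n x * G x $ i + u x * partial_deriv i (F n) x) * \<psi> x) \<longlonglongrightarrow>
        (\<phi> x * G x $ i + u x * P x $ i) * \<psi> x"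
        by (intro tendsto_intros F_tendsto elim)
      then show ?case by simp
    qed
    show "AE x in ?M. norm ((F n x * G x $ i + u x * partial_deriv i (F n) x) * \<psi> x)
        \<le> M * \<bar>G x $ i * \<psi> x\<bar> + L * \<bar>u x * \<psi> x\<bar>" for n
    proof (rule AE_I2)
      fix x
      have "\<bar>(F n x * G x $ i + u x * partial_deriv i (F n) x) * \<psi> x\<bar> =
          \<bar>F n x * (G x $ i * \<psi> x) + partial_deriv i (F n) x * (u x * \<psi> x)\<bar>"
        by (simp add: algebra_simps)
      also have "\<dots> \<le> \<bar>F n x\<bar> * \<bar>G x $ i * \<psi> x\<bar> + \<bar>partial_deriv i (F n) x\<bar> * \<bar>u x * \<psi> x\<bar>"
        unfolding abs_mult[symmetric] by (rule abs_triangle_ineq)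
      also have "\<dots> \<le> M * \<bar>G x $ i * \<psi> x\<bar> + L * \<bar>u x * \<psi> x\<bar>"
        by (intro add_mono mult_right_mono F_bound partial_deriv_F_bound) auto
      finally show "norm ((F n x * G x $ i + u x * partial_deriv i (F n) x) * \<psi> x)
        \<le> M * \<bar>G x $ i * \<psi> x\<bar> + L * \<bar>u x * \<psi> x\<bar>" by simp
    qed
  qed
  have "(LINT x|?M. F n x * u x * partial_deriv i \<psi> x) =
      - (LINT x|?M. (F n x * G x $ i + u x * partial_deriv i (F n) x) * \<psi> x)" for n
    by (rule weak_product_rule_smooth[OF open_B smooth_F u \<psi>])
  with lim1 have "(\<lambda>n. - (LINT x|?M. (F n x * G x $ i + u x * partial_deriv i (F n) x) * \<psi> x)) \<longlonglongrightarrow>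
      (LINT x|?M. \<phi> x * u x * partial_deriv i \<psi> x)" by simp
  then show "(LINT x|?M. \<phi> x * u x * partial_deriv i \<psi> x) = - (LINT x|?M. (\<phi> x *\<^sub>R G x + u x *\<^sub>R P x) $ i * \<psi> x)"
    using tendsto_minus[OF lim2] by (rule LIMSEQ_unique)
qed

lemma has_weak_gradient_phi: "has_weak_gradient B \<phi> P"
  using has_weak_gradient_mult[OF has_weak_gradient_const[OF open_B, of 1]] by simp

text \<open>The weak gradient of \<beta> is tested with (\<phi> \<psi>)^2. As \<phi> need not be
  smooth, \<open>F n\<close> first takes its place, which makes the square a genuine test function,
  and a limit follows.\<close>

lemma weak_ibp_test_functions:
  assumes \<beta>: "\<beta> \<in> Linf B" "has_weak_gradient B \<beta> H" "(\<lambda>x. H x $ i) \<in> Linf B"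
    and \<psi>: "\<psi> \<in> test_functions B"
  shows "(LINT x|lebesgue_on B. \<beta> x * (2 * \<phi> x * P x $ i * (\<psi> x)\<^sup>2 + 2 * (\<phi> x)\<^sup>2 * \<psi> x * partial_deriv i \<psi> x)) =
    - (LINT x|lebesgue_on B. H x $ i * ((\<phi> x)\<^sup>2 * (\<psi> x)\<^sup>2))"
proof -
  let ?M = "lebesgue_on B"
  interpret finite_measure ?M
    using open_B bounded_B by (intro finite_measure_lebesgue_on lmeasurable_open)
  note p = partial_deriv_test_functions[OF \<psi>, of i]
  obtain C1 where C1: "AE x in ?M. \<bar>\<psi> x\<bar> \<le> C1" using test_functions_Linf[OF \<psi>] by (auto simp: Linf_def)
  obtain C2 where C2: "AE x in ?M. \<bar>partial_deriv i \<psi> x\<bar> \<le> C2" using test_functions_Linf[OF p] by (auto simp: Linf_def)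
  obtain C3 where C3: "AE x in ?M. \<bar>\<beta> x\<bar> \<le> C3" using \<beta>(1) by (auto simp: Linf_def)
  obtain C4 where C4: "AE x in ?M. \<bar>H x $ i\<bar> \<le> C4" using \<beta>(3) by (auto simp: Linf_def)
  have meas: "\<beta> \<in> borel_measurable ?M" "(\<lambda>x. H x $ i) \<in> borel_measurable ?M"
    "\<psi> \<in> borel_measurable ?M" "partial_deriv i \<psi> \<in> borel_measurable ?M"
    using \<beta> test_functions_Linf[OF \<psi>] test_functions_Linf[OF p] by (auto simp: Linf_def)
  have F_m: "F n \<in> borel_measurable ?M" "partial_deriv i (F n) \<in> borel_measurable ?M" for n
    by (intro smooth_measurable_lebesgue_on smooth_partial_deriv smooth_F)+
  note [measurable] = meas F_m phi_measurable P_nth_measurable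
  have M0: "M \<ge> 0" using order_trans[OF abs_ge_zero F_bound[of 0 0]] .
  have L0: "L \<ge> 0" using order_trans[OF abs_ge_zero partial_deriv_F_bound[of i 0 0]] .
  have eq: "(LINT x|?M. \<beta> x * (2 * F n x * partial_deriv i (F n) x * (\<psi> x)\<^sup>2 + 2 * (F n x)\<^sup>2 * \<psi> x * partial_deriv i \<psi> x)) =
    - (LINT x|?M. H x $ i * ((F n x)\<^sup>2 * (\<psi> x)\<^sup>2))" for n
  proof -
    let ?g = "\<lambda>x. F n x * \<psi> x"
    have g: "?g \<in> test_functions B" by (rule test_functions_mult_smooth[OF smooth_F \<psi>])
    have gg: "(\<lambda>x. ?g x * ?g x) \<in> test_functions B"
      by (rule test_functions_mult_smooth[OF test_functions_smooth[OF g] g])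
    have dg: "partial_deriv i ?g x = F n x * partial_deriv i \<psi> x + partial_deriv i (F n) x * \<psi> x" for x
      by (intro partial_deriv_mult smooth_differentiable smooth_F test_functions_smooth[OF \<psi>])
    have "partial_deriv i (\<lambda>x. ?g x * ?g x) x = ?g x * partial_deriv i ?g x + partial_deriv i ?g x * ?g x" for x
      by (intro partial_deriv_mult smooth_differentiable test_functions_smooth[OF g])
    then have d: "partial_deriv i (\<lambda>x. ?g x * ?g x) x =
        2 * F n x * partial_deriv i (F n) x * (\<psi> x)\<^sup>2 + 2 * (F n x)\<^sup>2 * \<psi> x * partial_deriv i \<psi> x" for x
      unfolding dg by (simp add: power2_eq_square algebra_simps)
    have "(LINT x|?M. \<beta> x * partial_deriv i (\<lambda>x. ?g x * ?g x) x) = - (LINT x|?M. H x $ i * (?g x * ?g x))"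
      using \<beta>(2) gg by (simp add: has_weak_gradient_iff)
    then show ?thesis unfolding d by (simp add: power2_eq_square ac_simps)
  qed
  \<comment> \<open>A constant dominates here, because all factors are essentially bounded and B has
    finite measure.\<close>
  have lim1: "(\<lambda>n. LINT x|?M. \<beta> x * (2 * F n x * partial_deriv i (F n) x * (\<psi> x)\<^sup>2 + 2 * (F n x)\<^sup>2 * \<psi> x * partial_deriv i \<psi> x))
    \<longlonglongrightarrow> (LINT x|?M. \<beta> x * (2 * \<phi> x * P x $ i * (\<psi> x)\<^sup>2 + 2 * (\<phi> x)\<^sup>2 * \<psi> x * partial_deriv i \<psi> x))"
  proof (rule integral_dominated_convergence[where w="\<lambda>x. C3 * (2 * M * L * C1\<^sup>2 + 2 * M\<^sup>2 * C1 * C2)"])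
    show "AE x in ?M. (\<lambda>n. \<beta> x * (2 * F n x * partial_deriv i (F n) x * (\<psi> x)\<^sup>2 + 2 * (F n x)\<^sup>2 * \<psi> x * partial_deriv i \<psi> x))
      \<longlonglongrightarrow> \<beta> x * (2 * \<phi> x * P x $ i * (\<psi> x)\<^sup>2 + 2 * (\<phi> x)\<^sup>2 * \<psi> x * partial_deriv i \<psi> x)"
      using partial_tendsto[of i]
    proof eventually_elim
      case (elim x)
      then show ?case by (intro tendsto_intros F_tendsto)
    qed
    show "AE x in ?M. norm (\<beta> x * (2 * F n x * partial_deriv i (F n) x * (\<psi> x)\<^sup>2 + 2 * (F n x)\<^sup>2 * \<psi> x * partial_deriv i \<psi> x))
      \<le> C3 * (2 * M * L * C1\<^sup>2 + 2 * M\<^sup>2 * C1 * C2)" for n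
      using C1 C2 C3
    proof eventually_elim
      case (elim x)
      have C: "C1 \<ge> 0" "C2 \<ge> 0" "C3 \<ge> 0" using elim by auto
      have s: "(\<psi> x)\<^sup>2 \<le> C1\<^sup>2" "(F n x)\<^sup>2 \<le> M\<^sup>2"
        using power_mono[OF elim(1) abs_ge_zero, of 2] power_mono[OF F_bound[of n x] abs_ge_zero, of 2] by simp_all
      have "\<bar>2 * F n x * partial_deriv i (F n) x * (\<psi> x)\<^sup>2\<bar> \<le> 2 * M * L * C1\<^sup>2"
        unfolding abs_mult using s(1) M0 L0 by (intro mult_mono F_bound partial_deriv_F_bound) auto
      moreover have "\<bar>2 * (F n x)\<^sup>2 * \<psi> x * partial_deriv i \<psi> x\<bar> \<le> 2 * M\<^sup>2 * C1 * C2"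
        unfolding abs_mult using s(2) M0 C elim by (intro mult_mono) auto
      ultimately have "\<bar>2 * F n x * partial_deriv i (F n) x * (\<psi> x)\<^sup>2 + 2 * (F n x)\<^sup>2 * \<psi> x * partial_deriv i \<psi> x\<bar>
        \<le> 2 * M * L * C1\<^sup>2 + 2 * M\<^sup>2 * C1 * C2" by linarith
      then show ?case unfolding real_norm_def abs_mult[of "\<beta> x"] using elim(3) C by (intro mult_mono) auto
    qed
  qed simp_all
  have lim2: "(\<lambda>n. LINT x|?M. H x $ i * ((F n x)\<^sup>2 * (\<psi> x)\<^sup>2)) \<longlonglongrightarrow> (LINT x|?M. H x $ i * ((\<phi> x)\<^sup>2 * (\<psi> x)\<^sup>2))"
  proof (rule integral_dominated_convergence[where w="\<lambda>x. C4 * (M\<^sup>2 * C1\<^sup>2)"])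
    show "AE x in ?M. (\<lambda>n. H x $ i * ((F n x)\<^sup>2 * (\<psi> x)\<^sup>2)) \<longlonglongrightarrow> H x $ i * ((\<phi> x)\<^sup>2 * (\<psi> x)\<^sup>2)"
      by (intro AE_I2 tendsto_intros F_tendsto)
    show "AE x in ?M. norm (H x $ i * ((F n x)\<^sup>2 * (\<psi> x)\<^sup>2)) \<le> C4 * (M\<^sup>2 * C1\<^sup>2)" for n
      using C1 C4
    proof eventually_elim
      case (elim x)
      have C: "C4 \<ge> 0" using elim by auto
      have s: "(\<psi> x)\<^sup>2 \<le> C1\<^sup>2" "(F n x)\<^sup>2 \<le> M\<^sup>2"
        using power_mono[OF elim(1) abs_ge_zero, of 2] power_mono[OF F_bound[of n x] abs_ge_zero, of 2] by simp_all
      show ?case unfolding real_norm_def abs_mult using s elim C by (intro mult_mono) auto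
    qed
  qed simp_all
  show ?thesis
    using lim1 tendsto_minus[OF lim2] unfolding eq by (rule LIMSEQ_unique)
qed

end

section \<open>Approximation in \<open>H10\<close> and integration by parts\<close>

lemma norm_power2_eq_sum: "(norm v)\<^sup>2 = (\<Sum>i\<in>UNIV. (v $ i)\<^sup>2)" for v :: "real^'n::finite"
  unfolding norm_vec_def L2_set_def by (simp add: sum_nonneg)

lemma L2_nth:
  fixes V :: "real^'n::finite \<Rightarrow> real^'n"
  assumes "V \<in> L2 B"
  shows "(\<lambda>x. V x $ i) \<in> L2 B"
proof -
  have m: "V \<in> borel_measurable (lebesgue_on B)" "integrable (lebesgue_on B) (\<lambda>x. (norm (V x))\<^sup>2)"
    using assms by (auto simp: L2_def)
  have mi: "(\<lambda>x. V x $ i) \<in> borel_measurable (lebesgue_on B)"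
    using measurable_compose[OF m(1) borel_measurable_continuous_onI[OF
      linear_continuous_on[OF bounded_linear_vec_nth[of i]]]] .
  have "integrable (lebesgue_on B) (\<lambda>x. (V x $ i)\<^sup>2)"
  proof (rule Bochner_Integration.integrable_bound[OF m(2)])
    have "norm ((v $ i)\<^sup>2) \<le> norm ((norm v)\<^sup>2)" for v :: "real^'n"
      using power_mono[OF component_le_norm_cart[of v i] abs_ge_zero, of 2] by simp
    then show "AE x in lebesgue_on B. norm ((V x $ i)\<^sup>2) \<le> norm ((norm (V x))\<^sup>2)" by blast
  qed (use mi in measurable)
  with mi show ?thesis by (simp add: L2_iff_real)
qed

lemma L2_vecI:
  fixes V :: "real^'n::finite \<Rightarrow> real^'n"
  assumes "V \<in> borel_measurable (lebesgue_on B)" "\<And>i. (\<lambda>x. V x $ i) \<in> L2 B"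
  shows "V \<in> L2 B"
  using assms by (auto simp: L2_def norm_power2_eq_sum intro!: Bochner_Integration.integrable_sum)

lemma L2_AE_eq:
  fixes f g :: "real^'n::finite \<Rightarrow> real"
  assumes "f \<in> L2 B" "g \<in> borel_measurable (lebesgue_on B)" "AE x in lebesgue_on B. g x = f x"
  shows "g \<in> L2 B"
proof -
  have "integrable (lebesgue_on B) (\<lambda>x. (g x)\<^sup>2)"
  proof (rule integrable_cong_AE_imp)
    show "integrable (lebesgue_on B) (\<lambda>x. (f x)\<^sup>2)" using assms(1) by (simp add: L2_iff_real)
    show "AE x in lebesgue_on B. (f x)\<^sup>2 = (g x)\<^sup>2" using assms(3) by eventually_elim simp
  qed (use assms(2) in measurable)
  with assms(2) show ?thesis by (simp add: L2_iff_real)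
qed

lemma Linf_AE_eq:
  fixes f g :: "real^'n::finite \<Rightarrow> real"
  assumes "f \<in> Linf B" "g \<in> borel_measurable (lebesgue_on B)" "AE x in lebesgue_on B. g x = f x"
  shows "g \<in> Linf B"
proof -
  obtain M where "AE x in lebesgue_on B. norm (f x) \<le> M" using assms(1) by (auto simp: Linf_def)
  with assms(3) have "AE x in lebesgue_on B. norm (g x) \<le> M" by eventually_elim simp
  with assms(2) show ?thesis by (auto simp: Linf_def)
qed

lemma Linf_nth:
  fixes V :: "real^'n::finite \<Rightarrow> real^'n"
  assumes "V \<in> Linf B"
  shows "(\<lambda>x. V x $ i) \<in> Linf B"
proof -
  obtain M where V: "V \<in> borel_measurable (lebesgue_on B)" "AE x in lebesgue_on B. norm (V x) \<le> M"
    using assms by (auto simp: Linf_def)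
  have "(\<lambda>x. V x $ i) \<in> borel_measurable (lebesgue_on B)"
    using measurable_compose[OF V(1) borel_measurable_continuous_onI[OF
      linear_continuous_on[OF bounded_linear_vec_nth[of i]]]] .
  moreover have "AE x in lebesgue_on B. norm (V x $ i) \<le> M"
    using V(2) by eventually_elim (metis component_le_norm_cart order_trans real_norm_def)
  ultimately show ?thesis by (auto simp: Linf_def)
qed

lemma has_weak_gradient_nth_measurable:
  assumes "open B" "has_weak_gradient B u G"
  shows "(\<lambda>x. G x $ i) \<in> borel_measurable (lebesgue_on B)"
  using assms by (intro locally_integrable_on_measurable locally_integrable_on_nth) (auto simp: has_weak_gradient_iff)

text \<open>\<open>W1inf\<close> provides some bounded weak gradient; uniqueness carries the bound
  over to the chosen one.\<close>

lemma W1inf_weak_grad: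
  assumes B: "open B" and f: "f \<in> W1inf B"
  shows "has_weak_gradient B f (weak_grad B f)" "(\<lambda>x. weak_grad B f x $ i) \<in> Linf B"
proof -
  obtain G where G: "G \<in> Linf B" "has_weak_gradient B f G" using f by (auto simp: W1inf_def)
  show w: "has_weak_gradient B f (weak_grad B f)" using G(2) by (rule has_weak_gradient_weak_grad)
  have "AE x in lebesgue_on B. weak_grad B f x $ i = G x $ i"
    using weak_grad_AE_eq[OF B G(2)] by eventually_elim simp
  then show "(\<lambda>x. weak_grad B f x $ i) \<in> Linf B"
    by (rule Linf_AE_eq[OF Linf_nth[OF G(1)] has_weak_gradient_nth_measurable[OF B w]])
qed

lemma H1_weak_grad:
  assumes B: "open B" and f: "f \<in> H1 B"
  shows "has_weak_gradient B f (weak_grad B f)" "(\<lambda>x. weak_grad B f x $ i) \<in> L2 B"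
proof -
  obtain G where G: "G \<in> L2 B" "has_weak_gradient B f G" using f by (auto simp: H1_def)
  show w: "has_weak_gradient B f (weak_grad B f)" using G(2) by (rule has_weak_gradient_weak_grad)
  have "AE x in lebesgue_on B. weak_grad B f x $ i = G x $ i"
    using weak_grad_AE_eq[OF B G(2)] by eventually_elim simp
  then show "(\<lambda>x. weak_grad B f x $ i) \<in> L2 B"
    by (rule L2_AE_eq[OF L2_nth[OF G(1)] has_weak_gradient_nth_measurable[OF B w]])
qed

text \<open>\<open>H1_norm\<close> contains the chosen weak gradient of u - \<open>\<psi> k\<close>,
  which has to be identified almost everywhere with the difference of the gradients before
  convergence can be read off componentwise.\<close>

lemma H10_approx:
  fixes B :: "(real^'n::finite) set"
  assumes B: "open B" "bounded B" and u: "u \<in> H10 B"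
  obtains \<psi> where "\<And>k. \<psi> k \<in> test_functions B"
    "(\<lambda>k. LINT x|lebesgue_on B. (\<psi> k x - u x)\<^sup>2) \<longlonglongrightarrow> 0"
    "\<And>i. (\<lambda>k. LINT x|lebesgue_on B. (partial_deriv i (\<psi> k) x - weak_grad B u x $ i)\<^sup>2) \<longlonglongrightarrow> 0"
proof -
  let ?M = "lebesgue_on B"
  obtain \<psi> :: "nat \<Rightarrow> real^'n \<Rightarrow> real" where \<psi>: "\<And>k. \<psi> k \<in> test_functions B"
    and lim: "(\<lambda>k. H1_norm B (\<lambda>x. u x - \<psi> k x)) \<longlonglongrightarrow> 0"
    using u by (auto simp: H10_def)
  have uH: "u \<in> H1 B" "u \<in> L2 B" using u by (auto simp: H10_def H1_def)
  note G = H1_weak_grad[OF B(1) uH(1)]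
  have \<psi>L2: "\<psi> k \<in> L2 B" "partial_deriv i (\<psi> k) \<in> L2 B" for k i
    by (intro Linf_subset_L2 B test_functions_Linf partial_deriv_test_functions \<psi>)+
  define W where "W k = weak_grad B (\<lambda>x. u x - \<psi> k x)" for k
  have w: "has_weak_gradient B (\<lambda>x. u x - \<psi> k x) (\<lambda>x. weak_grad B u x - grad (\<psi> k) x)" for k
    by (intro has_weak_gradient_diff B G(1) has_weak_gradient_smooth test_functions_smooth[OF \<psi>])
  have W: "AE x in ?M. W k x = weak_grad B u x - grad (\<psi> k) x" for k
    unfolding W_def by (rule weak_grad_AE_eq[OF B(1) w])
  have Wm: "W k \<in> borel_measurable ?M" "(\<lambda>x. W k x $ i) \<in> borel_measurable ?M" for k i
    unfolding W_def using has_weak_gradient_weak_grad[OF w]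
    by (auto intro: has_weak_gradient_measurable has_weak_gradient_nth_measurable B)
  have WL2: "W k \<in> L2 B" for k
  proof (rule L2_vecI[OF Wm(1)])
    fix i
    show "(\<lambda>x. W k x $ i) \<in> L2 B"
    proof (rule L2_AE_eq[OF L2_diff[OF G(2) \<psi>L2(2)] Wm(2)])
      show "AE x in ?M. W k x $ i = weak_grad B u x $ i - partial_deriv i (\<psi> k) x"
        using W[of k] by eventually_elim simp
    qed
  qed
  define N where "N k = (LINT x|?M. (u x - \<psi> k x)\<^sup>2 + (norm (W k x))\<^sup>2)" for k
  \<comment> \<open>Without integrability the integral in the norm would be the default 0, and its
    convergence would say nothing.\<close>
  have int: "integrable ?M (\<lambda>x. (u x - \<psi> k x)\<^sup>2 + (norm (W k x))\<^sup>2)" for k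
    using L2_diff[OF uH(2) \<psi>L2(1)[of k]] WL2[of k] by (auto simp: L2_def)
  have "N k \<ge> 0" for k unfolding N_def by (intro Bochner_Integration.integral_nonneg) simp
  then have "N = (\<lambda>k. (H1_norm B (\<lambda>x. u x - \<psi> k x))\<^sup>2)"
    unfolding H1_norm_def N_def W_def by simp
  then have N: "N \<longlonglongrightarrow> 0" using tendsto_power[OF lim, of 2] by simp
  have squeeze: "(\<lambda>k. LINT x|?M. (h k x)\<^sup>2) \<longlonglongrightarrow> 0"
    if h: "\<And>k. h k \<in> L2 B" "\<And>k. AE x in ?M. (h k x)\<^sup>2 \<le> (u x - \<psi> k x)\<^sup>2 + (norm (W k x))\<^sup>2" for h :: "nat \<Rightarrow> real^'n \<Rightarrow> real"
  proof (rule Lim_null_comparison[OF _ N])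
    have "(LINT x|?M. (h k x)\<^sup>2) \<le> N k" for k
      unfolding N_def using h(1)[of k] by (intro integral_mono_AE int h(2)) (simp add: L2_iff_real)
    moreover have "0 \<le> (LINT x|?M. (h k x)\<^sup>2)" for k by simp
    ultimately show "\<forall>\<^sub>F k in sequentially. norm (LINT x|?M. (h k x)\<^sup>2) \<le> N k" by simp
  qed
  show thesis
  proof (rule that[OF \<psi>])
    show "(\<lambda>k. LINT x|?M. (\<psi> k x - u x)\<^sup>2) \<longlonglongrightarrow> 0"
      by (intro squeeze L2_diff \<psi>L2 uH) (simp add: power2_commute)
    show "(\<lambda>k. LINT x|?M. (partial_deriv i (\<psi> k) x - weak_grad B u x $ i)\<^sup>2) \<longlonglongrightarrow> 0" for i
    proof (intro squeeze L2_diff \<psi>L2 G)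
      fix k
      show "AE x in ?M. (partial_deriv i (\<psi> k) x - weak_grad B u x $ i)\<^sup>2 \<le> (u x - \<psi> k x)\<^sup>2 + (norm (W k x))\<^sup>2"
        using W[of k]
      proof eventually_elim
        case (elim x)
        have "(partial_deriv i (\<psi> k) x - weak_grad B u x $ i)\<^sup>2 = (W k x $ i)\<^sup>2"
          using elim by (simp add: power2_commute)
        also have "\<dots> \<le> (norm (W k x))\<^sup>2"
          using power_mono[OF component_le_norm_cart[of "W k x" i] abs_ge_zero, of 2] by simp
        finally show ?case by (simp add: add_increasing)
      qed
    qed
  qed
qed

context gradient_approximation
begin

text \<open>The i-th derivative of \<beta> (\<phi> u)^2 integrates to 0, since u is a limit of test
  functions. The integrands are grouped as bounded coefficient times a product of two L2 functions,
  the shape that \<open>L2_limit_mult\<close> handles.\<close>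

lemma weak_ibp:
  assumes \<beta>: "\<beta> \<in> Linf B" "has_weak_gradient B \<beta> H" "(\<lambda>x. H x $ i) \<in> Linf B"
    and u: "u \<in> H10 B"
  shows "2 * (LINT x|lebesgue_on B. (\<beta> x * \<phi> x * P x $ i) * (u x * u x)) +
      2 * (LINT x|lebesgue_on B. (\<beta> x * (\<phi> x)\<^sup>2) * (u x * weak_grad B u x $ i)) =
    - (LINT x|lebesgue_on B. (H x $ i * (\<phi> x)\<^sup>2) * (u x * u x))"
proof -
  let ?M = "lebesgue_on B"
  obtain \<psi> where \<psi>: "\<And>k. \<psi> k \<in> test_functions B"
    and lim0: "(\<lambda>k. LINT x|?M. (\<psi> k x - u x)\<^sup>2) \<longlonglongrightarrow> 0"
    and lim1: "\<And>i. (\<lambda>k. LINT x|?M. (partial_deriv i (\<psi> k) x - weak_grad B u x $ i)\<^sup>2) \<longlonglongrightarrow> 0"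
    using H10_approx[OF open_B bounded_B u] by blast
  have uH: "u \<in> H1 B" "u \<in> L2 B" using u by (auto simp: H10_def H1_def)
  note G = H1_weak_grad(2)[OF open_B uH(1), of i]
  have \<psi>L2: "\<psi> k \<in> L2 B" "partial_deriv i (\<psi> k) \<in> L2 B" for k
    by (intro Linf_subset_L2 open_B bounded_B test_functions_Linf partial_deriv_test_functions \<psi>)+
  have \<phi>2: "(\<lambda>x. (\<phi> x)\<^sup>2) \<in> Linf B"
    unfolding power2_eq_square by (intro Linf_mult phi_Linf)
  have c1: "(\<lambda>x. \<beta> x * \<phi> x * P x $ i) \<in> Linf B" by (intro Linf_mult \<beta> phi_Linf P_Linf)
  have c2: "(\<lambda>x. \<beta> x * (\<phi> x)\<^sup>2) \<in> Linf B" by (intro Linf_mult \<beta> \<phi>2)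
  have c3: "(\<lambda>x. H x $ i * (\<phi> x)\<^sup>2) \<in> Linf B" by (intro Linf_mult \<beta> \<phi>2)
  note l1 = L2_limit_mult[OF c1 uH(2) \<psi>L2(1) uH(2) \<psi>L2(1) lim0 lim0]
  note l2 = L2_limit_mult[OF c2 uH(2) \<psi>L2(1) G \<psi>L2(2) lim0 lim1]
  note l3 = L2_limit_mult[OF c3 uH(2) \<psi>L2(1) uH(2) \<psi>L2(1) lim0 lim0]
  have eq: "2 * (LINT x|?M. (\<beta> x * \<phi> x * P x $ i) * (\<psi> k x * \<psi> k x)) +
      2 * (LINT x|?M. (\<beta> x * (\<phi> x)\<^sup>2) * (\<psi> k x * partial_deriv i (\<psi> k) x)) =
    - (LINT x|?M. (H x $ i * (\<phi> x)\<^sup>2) * (\<psi> k x * \<psi> k x))" for k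
  proof -
    note i1 = Linf_mult_integrable[OF c1 L2_mult_integrable[OF \<psi>L2(1) \<psi>L2(1)], of k k]
    note i2 = Linf_mult_integrable[OF c2 L2_mult_integrable[OF \<psi>L2(1) \<psi>L2(2)], of k k]
    have "2 * (LINT x|?M. (\<beta> x * \<phi> x * P x $ i) * (\<psi> k x * \<psi> k x)) +
      2 * (LINT x|?M. (\<beta> x * (\<phi> x)\<^sup>2) * (\<psi> k x * partial_deriv i (\<psi> k) x)) =
      (LINT x|?M. 2 * ((\<beta> x * \<phi> x * P x $ i) * (\<psi> k x * \<psi> k x)) + 2 * ((\<beta> x * (\<phi> x)\<^sup>2) * (\<psi> k x * partial_deriv i (\<psi> k) x)))"
      using i1 i2 by (subst Bochner_Integration.integral_add) auto
    also have "\<dots> = (LINT x|?M. \<beta> x * (2 * \<phi> x * P x $ i * (\<psi> k x)\<^sup>2 + 2 * (\<phi> x)\<^sup>2 * \<psi> k x * partial_deriv i (\<psi> k) x))"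
      by (simp add: power2_eq_square algebra_simps)
    also have "\<dots> = - (LINT x|?M. H x $ i * ((\<phi> x)\<^sup>2 * (\<psi> k x)\<^sup>2))"
      by (rule weak_ibp_test_functions[OF \<beta> \<psi>])
    finally show ?thesis by (simp add: power2_eq_square ac_simps)
  qed
  show ?thesis
    by (rule LIMSEQ_unique[OF tendsto_add[OF tendsto_mult[OF tendsto_const l1] tendsto_mult[OF tendsto_const l2]]])
       (unfold eq, rule tendsto_minus[OF l3])
qed

end

section \<open>The phase-field function\<close>

text \<open>For points on opposite sides, the segment between them meets the frontier in a point at
  distance 0 from both S and its complement, so the two distances together are at most
  \<open>dist x y\<close>. On one side it is the triangle inequality for
  \<open>infdist\<close>.\<close>

lemma signed_distance_lipschitz:
  fixes S :: "(real^'n::finite) set"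
  assumes "S \<noteq> {}" "- S \<noteq> {}"
  shows "\<bar>signed_distance S x - signed_distance S y\<bar> \<le> dist x y"
proof -
  have opposite: "infdist x (- S) + infdist y S \<le> dist x y" if "x \<in> S" "y \<notin> S" for x y
  proof -
    have "closed_segment x y \<inter> frontier S \<noteq> {}"
    proof (rule connected_Int_frontier)
      show "closed_segment x y \<inter> S \<noteq> {}" "closed_segment x y - S \<noteq> {}"
        using that ends_in_segment[of x y] by blast+
    qed simp
    then obtain z where z: "z \<in> closed_segment x y" "z \<in> closure S" "z \<in> closure (- S)"
      by (auto simp: frontier_closures)
    have "infdist z S = 0" "infdist z (- S) = 0"
      using z assms by (simp_all flip: in_closure_iff_infdist_zero)
    then have "infdist x (- S) \<le> dist x z" "infdist y S \<le> dist z y"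
      using infdist_triangle[of x "- S" z] infdist_triangle[of y S z] by (simp_all add: dist_commute)
    moreover have "dist x y = dist x z + dist z y"
      using z(1) by (simp add: between flip: between_mem_segment)
    ultimately show ?thesis by linarith
  qed
  show ?thesis
  proof (cases "x \<in> S"; cases "y \<in> S")
    assume "x \<in> S" "y \<in> S"
    then show ?thesis using infdist_triangle_abs[of y "- S" x] by (simp add: signed_distance_def dist_commute)
  next
    assume "x \<in> S" "y \<notin> S"
    then show ?thesis using opposite[of x y] infdist_nonneg[of x "- S"] infdist_nonneg[of y S]
      by (simp add: signed_distance_def)
  next
    assume "x \<notin> S" "y \<in> S"
    then show ?thesis using opposite[of y x] infdist_nonneg[of y "- S"] infdist_nonneg[of x S]
      by (simp add: signed_distance_def dist_commute)
  next
    assume "x \<notin> S" "y \<notin> S"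
    then show ?thesis using infdist_triangle_abs[of x S y] by (simp add: signed_distance_def)
  qed
qed

lemma tanh_lipschitz: "\<bar>tanh s - tanh t\<bar> \<le> \<bar>s - t\<bar>" for s t :: real
proof -
  have "norm (tanh s - tanh t) \<le> 1 * norm (s - t)"
  proof (rule field_differentiable_bound[of UNIV tanh "\<lambda>x. 1 - (tanh x)\<^sup>2"])
    fix z :: real
    have "cosh z \<noteq> 0" using cosh_real_pos[of z] by simp
    then show "(tanh has_field_derivative 1 - (tanh z)\<^sup>2) (at z within UNIV)"
      by (auto intro!: derivative_eq_intros)
    have "(tanh z)\<^sup>2 \<le> 1"
      using tanh_real_bounds[of z] by (simp add: abs_square_le_1 abs_le_iff)
    then show "norm (1 - (tanh z)\<^sup>2) \<le> 1" by simp
  qed auto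
  then show ?thesis by simp
qed

lemma phase_field_bounds: "0 \<le> phase_field \<epsilon> S x" "phase_field \<epsilon> S x \<le> 1"
  using tanh_real_bounds[of "3 * signed_distance S x / \<epsilon>"] by (auto simp: phase_field_def)

text \<open>The constant is 1/2 times 3 / \<epsilon>; both tanh and the signed distance have
  Lipschitz constant 1.\<close>

lemma phase_field_lipschitz:
  fixes S :: "(real^'n::finite) set"
  assumes "\<epsilon> > 0" "S \<noteq> {}" "- S \<noteq> {}"
  shows "\<bar>phase_field \<epsilon> S x - phase_field \<epsilon> S y\<bar> \<le> 3 / (2 * \<epsilon>) * dist x y"
proof -
  let ?r = "signed_distance S"
  have "\<bar>phase_field \<epsilon> S x - phase_field \<epsilon> S y\<bar> = 1/2 * \<bar>tanh (3 * ?r x / \<epsilon>) - tanh (3 * ?r y / \<epsilon>)\<bar>"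
  proof -
    have "1/2 * (1 - s) - 1/2 * (1 - t) = 1/2 * (t - s)" for s t :: real by argo
    then show ?thesis unfolding phase_field_def by (simp only: abs_mult abs_minus_commute)
  qed
  also have "\<dots> \<le> 1/2 * \<bar>3 * ?r x / \<epsilon> - 3 * ?r y / \<epsilon>\<bar>"
    by (intro mult_left_mono tanh_lipschitz) simp
  also have "\<dots> = 3 / (2 * \<epsilon>) * \<bar>?r x - ?r y\<bar>"
  proof -
    have "3 * ?r x / \<epsilon> - 3 * ?r y / \<epsilon> = (3 / \<epsilon>) * (?r x - ?r y)"
      by (simp add: diff_divide_distrib right_diff_distrib)
    then show ?thesis using assms(1) by (simp only: abs_mult) simp
  qed
  also have "\<dots> \<le> 3 / (2 * \<epsilon>) * dist x y"
    using assms by (intro mult_left_mono signed_distance_lipschitz) auto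
  finally show ?thesis .
qed

theorem theorem5p5:
  fixes \<Omega> B :: "(real^'n::finite) set"
    and \<epsilon> d :: real
    and D m :: "real^'n \<Rightarrow> real"
    and b :: "real^'n \<Rightarrow> real^'n"
  assumes "open_domain \<Omega>" "bounded \<Omega>" "Ck_boundary 1 \<Omega>"
    and "open_domain B" "bounded B" "\<Omega> \<subset> B"
    and "\<epsilon> > 0"
    and "D \<in> borel_measurable (lebesgue_on B)" "bounded (D ` B)"
    and "d > 0" "\<forall>x\<in>B. d \<le> D x"
    and "\<forall>i. (\<lambda>x. b x $ i) \<in> W1inf B"
    and "m \<in> Linf B"
    and "AE x in lebesgue_on B. m x - (1/2) * weak_div B b x \<ge> 0"
  shows "\<exists>C>0. \<forall>u\<in>H10 B.
           phase_field_form B \<epsilon> (phase_field \<epsilon> \<Omega>) D b m u u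
             \<ge> C * (phase_field_norm B \<epsilon> (phase_field \<epsilon> \<Omega>) u)\<^sup>2"
proof (intro exI[of _ d] conjI ballI)
  show "d > 0" by fact
  fix u assume u: "u \<in> H10 B"
  let ?M = "lebesgue_on B"
  define \<phi> where "\<phi> = phase_field \<epsilon> \<Omega>"
  define L where "L = 3 / (2 * \<epsilon>)"
  have B: "open B" "bounded B" using assms(4,5) by (auto simp: open_domain_def)
  \<comment> \<open>The strict inclusion in B provides a point outside \<Omega>.\<close>
  have "\<Omega> \<noteq> {}" "- \<Omega> \<noteq> {}" using assms(1,6) by (auto simp: open_domain_def)
  then have lip: "\<bar>\<phi> x - \<phi> y\<bar> \<le> L * dist x y" for x y
    unfolding \<phi>_def L_def by (rule phase_field_lipschitz[OF assms(7)])
  have \<phi>01: "0 \<le> \<phi> x" "\<phi> x \<le> 1" for x unfolding \<phi>_def by (rule phase_field_bounds)+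
  obtain F P where F: "\<And>n. smooth (F n)" "\<And>n x. \<bar>F n x - \<phi> x\<bar> \<le> 1 / Suc n"
      "\<And>n i x. \<bar>partial_deriv i (F n) x\<bar> \<le> L"
    and P: "P \<in> borel_measurable ?M" "AE x in ?M. (\<lambda>n. grad (F n) x) \<longlonglongrightarrow> P x"
    using lipschitz_gradient_approx[OF B lip] by blast
  \<comment> \<open>The bound 2 arises because \<open>F n\<close> is within 1 of \<phi>, whose
    values lie in [0, 1].\<close>
  interpret gradient_approximation B F \<phi> P 2 L
  proof
    fix n x i
    have "1 / real (Suc n) \<le> 1" by simp
    then show "\<bar>F n x\<bar> \<le> 2" using F(2)[of n x] \<phi>01[of x] by linarith
    have "(\<lambda>n. F n x - \<phi> x) \<longlonglongrightarrow> 0"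
      by (rule Lim_null_comparison[OF _ LIMSEQ_inverse_real_of_nat]) (use F(2) in \<open>simp add: inverse_eq_divide\<close>)
    then show "(\<lambda>n. F n x) \<longlonglongrightarrow> \<phi> x" by (simp add: LIM_zero_iff)
  qed (use B F P in auto)
  have uH: "u \<in> H1 B" "u \<in> L2 B" using u by (auto simp: H10_def H1_def)
  define G where "G = weak_grad B u"
  have G: "has_weak_gradient B u G" "\<And>i. (\<lambda>x. G x $ i) \<in> L2 B"
    unfolding G_def using H1_weak_grad[OF B(1) uH(1)] by auto
  define V where "V = weak_grad B (\<lambda>x. \<phi> x * u x)"
  have V: "has_weak_gradient B (\<lambda>x. \<phi> x * u x) V" "AE x in ?M. V x = \<phi> x *\<^sub>R G x + u x *\<^sub>R P x"
    unfolding V_def using has_weak_gradient_mult[OF G(1)]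
    by (auto intro: has_weak_gradient_weak_grad weak_grad_AE_eq B)
  define Q where "Q = weak_grad B \<phi>"
  have Q: "has_weak_gradient B \<phi> Q" "AE x in ?M. Q x = P x"
    unfolding Q_def using has_weak_gradient_phi
    by (auto intro: has_weak_gradient_weak_grad weak_grad_AE_eq B)
  define H where "H i = weak_grad B (\<lambda>x. b x $ i)" for i
  have H: "has_weak_gradient B (\<lambda>x. b x $ i) (H i)" "(\<lambda>x. H i x $ j) \<in> Linf B" for i j
    unfolding H_def using W1inf_weak_grad[OF B(1)] assms(12) by auto
  have b: "(\<lambda>x. b x $ i) \<in> Linf B" for i using assms(12) by (auto simp: W1inf_def)
  have D: "D \<in> Linf B"
  proof -
    obtain K where "\<And>x. x \<in> B \<Longrightarrow> \<bar>D x\<bar> \<le> K"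
      using assms(9) unfolding bounded_iff by (metis imageI real_norm_def)
    then have "AE x in ?M. norm (D x) \<le> K" by (intro AE_I2) auto
    with assms(8) show ?thesis by (auto simp: Linf_def)
  qed
  have V_meas: "V \<in> borel_measurable ?M" "(\<lambda>x. V x $ i) \<in> borel_measurable ?M" for i
    using V(1) by (auto intro: has_weak_gradient_measurable has_weak_gradient_nth_measurable B)
  have V_L2: "V \<in> L2 B"
  proof (rule L2_vecI[OF V_meas(1)])
    fix i
    have "(\<lambda>x. \<phi> x * G x $ i + P x $ i * u x) \<in> L2 B"
      by (intro L2_add Linf_L2_mult phi_Linf P_Linf G uH)
    moreover have "AE x in ?M. V x $ i = \<phi> x * G x $ i + P x $ i * u x"
      using V(2) by eventually_elim simp
    ultimately show "(\<lambda>x. V x $ i) \<in> L2 B" by (rule L2_AE_eq[OF _ V_meas(2)])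
  qed
  \<comment> \<open>T1 is the two diffusive terms together, T2 to T5 are the other terms of the form
    in their order. Y1 and Y2 come from T3 by integration by parts: they stand for \<phi> (b . grad
    \<phi>) u^2 and \<phi>^2 (div b) u^2.\<close>
  define T1 where "T1 x = D x * (norm (V x))\<^sup>2" for x
  define T2 where "T2 x = (D x * (1 / \<epsilon>\<^sup>2) * (1 - \<phi> x)) * (u x * u x)" for x
  define T3 where "T3 x = (\<Sum>i\<in>UNIV. (b x $ i * (\<phi> x)\<^sup>2) * (u x * G x $ i))" for x
  define T4 where "T4 x = (\<phi> x * max (\<Sum>i\<in>UNIV. b x $ i * P x $ i) 0) * (u x * u x)" for x
  define T5 where "T5 x = (\<phi> x * \<phi> x * m x) * (u x * u x)" for x
  define Y1 where "Y1 x = (\<Sum>i\<in>UNIV. (b x $ i * \<phi> x * P x $ i) * (u x * u x))" for x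
  define Y2 where "Y2 x = (\<Sum>i\<in>UNIV. (H i x $ i * (\<phi> x)\<^sup>2) * (u x * u x))" for x
  note uu = L2_mult_integrable[OF uH(2) uH(2)]
  have V_int: "integrable ?M (\<lambda>x. (norm (V x))\<^sup>2)" using V_L2 by (simp add: L2_def)
  have \<phi>2: "(\<lambda>x. (\<phi> x)\<^sup>2) \<in> Linf B"
    unfolding power2_eq_square by (intro Linf_mult phi_Linf)
  have int1: "integrable ?M T1" unfolding T1_def by (intro Linf_mult_integrable D V_int)
  have int2: "integrable ?M T2" unfolding T2_def
    by (intro Linf_mult_integrable Linf_mult Linf_diff Linf_const D phi_Linf uu)
  have int3: "integrable ?M (\<lambda>x. (b x $ i * (\<phi> x)\<^sup>2) * (u x * G x $ i))" for i
    by (intro Linf_mult_integrable Linf_mult \<phi>2 b L2_mult_integrable uH G)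
  have int4: "integrable ?M T4" unfolding T4_def
    by (intro Linf_mult_integrable Linf_mult Linf_max_0 Linf_sum b P_Linf phi_Linf uu)
  have int5: "integrable ?M T5" unfolding T5_def
    by (intro Linf_mult_integrable Linf_mult phi_Linf uu assms(13))
  have intY1: "integrable ?M (\<lambda>x. (b x $ i * \<phi> x * P x $ i) * (u x * u x))" for i
    by (intro Linf_mult_integrable Linf_mult phi_Linf P_Linf b uu)
  have intY2: "integrable ?M (\<lambda>x. (H i x $ i * (\<phi> x)\<^sup>2) * (u x * u x))" for i
    by (intro Linf_mult_integrable Linf_mult \<phi>2 H uu)
  have intT3: "integrable ?M T3" unfolding T3_def by (intro Bochner_Integration.integrable_sum int3)
  have intY: "integrable ?M Y1" "integrable ?M Y2"
    unfolding Y1_def Y2_def by (intro Bochner_Integration.integrable_sum intY1 intY2)+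
  \<comment> \<open>\<open>weak_ibp\<close> for the i-th component of b in direction i, summed over
    i; the diagonal entries \<open>H i x $ i\<close> add up to the divergence.\<close>
  have ibp: "2 * integral\<^sup>L ?M Y1 + 2 * integral\<^sup>L ?M T3 = - integral\<^sup>L ?M Y2"
  proof -
    have "2 * (LINT x|?M. (b x $ i * \<phi> x * P x $ i) * (u x * u x)) +
        2 * (LINT x|?M. (b x $ i * (\<phi> x)\<^sup>2) * (u x * G x $ i)) =
      - (LINT x|?M. (H i x $ i * (\<phi> x)\<^sup>2) * (u x * u x))" for i
      unfolding G_def by (rule weak_ibp[OF b H(1) H(2) u])
    then have "(\<Sum>i\<in>UNIV. 2 * (LINT x|?M. (b x $ i * \<phi> x * P x $ i) * (u x * u x)) +
        2 * (LINT x|?M. (b x $ i * (\<phi> x)\<^sup>2) * (u x * G x $ i))) =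
      (\<Sum>i\<in>UNIV. - (LINT x|?M. (H i x $ i * (\<phi> x)\<^sup>2) * (u x * u x)))"
      by simp
    then show ?thesis unfolding Y1_def Y2_def T3_def
      by (simp only: Bochner_Integration.integral_sum[OF int3] Bochner_Integration.integral_sum[OF intY1]
          Bochner_Integration.integral_sum[OF intY2] sum.distrib sum_negf sum_distrib_left)
  qed
  have meas: "\<phi> \<in> borel_measurable ?M" "u \<in> borel_measurable ?M" "D \<in> borel_measurable ?M"
    "m \<in> borel_measurable ?M" "\<And>i. (\<lambda>x. b x $ i) \<in> borel_measurable ?M"
    "\<And>i. (\<lambda>x. G x $ i) \<in> borel_measurable ?M" "\<And>i. (\<lambda>x. Q x $ i) \<in> borel_measurable ?M"
    using phi_measurable uH(2) G(2) D assms(13) b has_weak_gradient_nth_measurable[OF B(1) Q(1)]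
    by (auto simp: L2_iff_real Linf_def)
  note [measurable] = meas V_meas
  \<comment> \<open>V and Q are chosen weak gradients and obey the product rule only almost
    everywhere, so the integrands are compared by \<open>integral_cong_AE\<close>, which asks for
    measurability of both.\<close>
  have form: "phase_field_form B \<epsilon> \<phi> D b m u u = (LINT x|?M. T1 x + T2 x + T3 x + T4 x + T5 x)"
    unfolding phase_field_form_def G_def[symmetric] V_def[symmetric] Q_def[symmetric]
  proof (rule integral_cong_AE)
    show "(\<lambda>x. \<phi> x * D x * (G x \<bullet> V x) + D x * (Q x \<bullet> V x) * u x + D x / \<epsilon>\<^sup>2 * (1 - \<phi> x) * u x * u x
      + (\<phi> x)\<^sup>2 * (b x \<bullet> G x) * u x + \<phi> x * max (b x \<bullet> Q x) 0 * u x * u x + (\<phi> x)\<^sup>2 * m x * u x * u x)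
      \<in> borel_measurable ?M"
      unfolding inner_vec_def inner_real_def by measurable
    show "(\<lambda>x. T1 x + T2 x + T3 x + T4 x + T5 x) \<in> borel_measurable ?M"
      using int1 int2 intT3 int4 int5 by (intro borel_measurable_add borel_measurable_integrable)
    show "AE x in ?M. \<phi> x * D x * (G x \<bullet> V x) + D x * (Q x \<bullet> V x) * u x + D x / \<epsilon>\<^sup>2 * (1 - \<phi> x) * u x * u x
      + (\<phi> x)\<^sup>2 * (b x \<bullet> G x) * u x + \<phi> x * max (b x \<bullet> Q x) 0 * u x * u x + (\<phi> x)\<^sup>2 * m x * u x * u x
      = T1 x + T2 x + T3 x + T4 x + T5 x"
      using V(2) Q(2)
    proof eventually_elim
      case (elim x)
      have "T1 x = D x * ((\<phi> x *\<^sub>R G x + u x *\<^sub>R P x) \<bullet> V x)"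
        using elim(1) by (simp add: T1_def power2_norm_eq_inner)
      then have 1: "\<phi> x * D x * (G x \<bullet> V x) + D x * (Q x \<bullet> V x) * u x = T1 x"
        using elim(2) by (simp add: inner_add_left algebra_simps)
      have 3: "(\<phi> x)\<^sup>2 * (b x \<bullet> G x) * u x = T3 x"
        by (simp add: T3_def inner_vec_def sum_distrib_left sum_distrib_right ac_simps)
      have 4: "\<phi> x * max (b x \<bullet> Q x) 0 * u x * u x = T4 x"
        using elim(2) by (simp add: T4_def inner_vec_def ac_simps)
      have 2: "D x / \<epsilon>\<^sup>2 * (1 - \<phi> x) * u x * u x = T2 x" by (simp add: T2_def)
      have 5: "(\<phi> x)\<^sup>2 * m x * u x * u x = T5 x" by (simp add: T5_def power2_eq_square ac_simps)
      show ?case unfolding 1 2 3 4 5 ..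
    qed
  qed
  define N where "N x = (norm (V x))\<^sup>2 + (1 / \<epsilon>\<^sup>2) * (1 - \<phi> x) * (u x)\<^sup>2" for x
  have intN: "integrable ?M N"
  proof -
    have "integrable ?M (\<lambda>x. ((1 / \<epsilon>\<^sup>2) * (1 - \<phi> x)) * (u x * u x))"
      by (intro Linf_mult_integrable Linf_mult Linf_diff Linf_const phi_Linf uu)
    then show ?thesis unfolding N_def power2_eq_square[of "u _"] using V_int by simp
  qed
  have N0: "N x \<ge> 0" for x unfolding N_def using \<phi>01[of x] by simp
  have norm: "(phase_field_norm B \<epsilon> \<phi> u)\<^sup>2 = integral\<^sup>L ?M N"
    unfolding phase_field_norm_def V_def[symmetric] N_def[symmetric]
    using Bochner_Integration.integral_nonneg[of ?M N, OF N0] by simp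
  have "d * integral\<^sup>L ?M N = (LINT x|?M. d * N x)" using intN by simp
  \<comment> \<open>By \<open>ibp\<close> the right-hand side has the value of the form: T3 is
    traded for - Y1 - Y2 / 2, after which a pointwise lower bound is available.\<close>
  also have "\<dots> \<le> (LINT x|?M. T1 x + T2 x + (T4 x - Y1 x) + (T5 x - 1/2 * Y2 x))"
  proof (rule integral_mono_AE)
    show "integrable ?M (\<lambda>x. d * N x)" using intN by simp
    show "integrable ?M (\<lambda>x. T1 x + T2 x + (T4 x - Y1 x) + (T5 x - 1/2 * Y2 x))"
      by (intro Bochner_Integration.integrable_add Bochner_Integration.integrable_diff integrable_mult_right
          int1 int2 int4 int5 intY)
    show "AE x in ?M. d * N x \<le> T1 x + T2 x + (T4 x - Y1 x) + (T5 x - 1/2 * Y2 x)"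
      using assms(14) AE_space
    proof eventually_elim
      case (elim x)
      have "x \<in> B" using elim(2) by simp
      then have "d \<le> D x" using assms(11) by blast
      \<comment> \<open>D multiplies the gradient term and the penalty term alike, which is why the
        constant d does not depend on \<epsilon>.\<close>
      moreover have "T1 x + T2 x = D x * N x"
        by (simp add: T1_def T2_def N_def power2_eq_square[of "u x"] algebra_simps)
      ultimately have 1: "d * N x \<le> T1 x + T2 x" using N0[of x] by (simp add: mult_right_mono)
      let ?s = "\<Sum>i\<in>UNIV. b x $ i * P x $ i"
      have "Y1 x = (\<phi> x * ?s) * (u x * u x)"
        by (simp add: Y1_def sum_distrib_left sum_distrib_right ac_simps)
      \<comment> \<open>What remains is the negative part of b . grad \<phi>: the positive part in
        the form exists to compensate the sign-indefinite term produced by integration by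
        parts.\<close>
      then have "T4 x - Y1 x = \<phi> x * (max ?s 0 - ?s) * (u x * u x)"
        by (simp add: T4_def algebra_simps)
      then have 2: "T4 x - Y1 x \<ge> 0" using \<phi>01(1)[of x] by simp
      have "Y2 x = ((\<phi> x * \<phi> x) * weak_div B b x) * (u x * u x)"
        by (simp add: Y2_def weak_div_def H_def sum_distrib_left sum_distrib_right power2_eq_square ac_simps)
      then have "T5 x - 1/2 * Y2 x = (\<phi> x * \<phi> x) * (m x - 1/2 * weak_div B b x) * (u x * u x)"
        by (simp add: T5_def algebra_simps)
      then have 3: "T5 x - 1/2 * Y2 x \<ge> 0" using elim(1) \<phi>01(1)[of x] by simp
      show ?case using 1 2 3 by linarith
    qed
  qed
  also have "\<dots> = integral\<^sup>L ?M T1 + integral\<^sup>L ?M T2 + (integral\<^sup>L ?M T4 - integral\<^sup>L ?M Y1)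
      + (integral\<^sup>L ?M T5 - 1/2 * integral\<^sup>L ?M Y2)"
    using int1 int2 int4 int5 intY by simp
  also have "\<dots> = integral\<^sup>L ?M T1 + integral\<^sup>L ?M T2 + integral\<^sup>L ?M T3 + integral\<^sup>L ?M T4 + integral\<^sup>L ?M T5"
    using ibp by argo
  also have "\<dots> = phase_field_form B \<epsilon> \<phi> D b m u u"
    unfolding form using int1 int2 intT3 int4 int5 by simp
  finally show "d * (phase_field_norm B \<epsilon> (phase_field \<epsilon> \<Omega>) u)\<^sup>2 \<le> phase_field_form B \<epsilon> (phase_field \<epsilon> \<Omega>) D b m u u"
    unfolding norm[symmetric] \<phi>_def .
qed

end
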